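(* Let $a,b\in BC^1(\Pi;\mathbb M_n)$, with $a$ diagonal and satisfying the strict hyperbolicity condition (H) given in the context. Let $J_0,J_1$ be the $n\times n$ matrices defined in the context from the boundary coefficients $r_{jk}$. Assume that there exist positive constants $\beta_1,\beta_2,\beta_3,\beta_4$ and a diagonal matrix $V(x,t)=\mathrm{diag}(V_1(x,t),\dots,V_n(x,t))$ with continuously differentiable entries in $\Pi$ such that the following conditions are satisfied: (i) $\beta_1\|v\|^2\le\langle V(x,t)v,v\rangle\le\beta_2\|v\|^2$ for all $(x,t)\in\Pi$ and $v\in\mathbb R^n$; (ii) $\big\langle\big(\partial_tV+\partial_x(Va)-Vb-b^TV\big)v,v\big\rangle<-\beta_3\|v\|^2$ for all $(x,t)\in\Pi$ and all nonzero $v\in\mathbb R^n$; (iii) $\big\langle\big(J_0^TV(0,t)a(0,t)J_0-J_1^TV(1,t)a(1,t)J_1\big)v,v\big\rangle<-\beta_4\|v\|^2$ for all $t\in\mathbb R$ and all nonzero $v\in\mathbb R^n$. Then the problem $$\partial_tu+a(x,t)\partial_xu+b(x,t)u=0,\ x\in(0,1),\qquad u_j(0,t)=R_ju(\cdot,t),\ 1\le j\le m,\qquad u_j(1,t)=R_ju(\cdot,t),\ m<j\le n,$$ is robust exponentially stable in $L^2((0,1);\mathbb R^n)$.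
   Context: **Setting.** $\Pi=\{(x,t)\in\mathbb R^2:0\le x\le1\}$; $n\ge2$ and $0\le m\le n$ are integers; $\mathbb M_n$ is the space of real $n\times n$ matrices; $\langle\cdot,\cdot\rangle$ is the scalar product in $\mathbb R^n$; $\|\cdot\|$ is the max norm for vectors and matrices (maximum absolute value of the entries). $BC^1(\Pi;\mathbb M_n)$ is the space of continuously differentiable functions bounded together with their first partial derivatives, with the usual norm. $a=\mathrm{diag}(a_1,\dots,a_n)$, $b=(b_{jk})_{j,k=1}^n$. The operators $R_j:C([0,1];\mathbb R^n)\to\mathbb R$ are $R_jv=\sum_{k=m+1}^nr_{jk}v_k(0)+\sum_{k=1}^mr_{jk}v_k(1)$, $j\le n$, with real constants $r_{jk}$. **(H)** There is $a_0>0$ such that $\inf\{a_j(x,t):(x,t)\in\Pi,\,1\le j\le m\}\ge a_0$, $\sup\{a_j(x,t):(x,t)\in\Pi,\,m+1\le j\le n\}\le-a_0$, $\inf\{|a_j(x,t)-a_k(x,t)|:(x,t)\in\Pi,\,1\le j\ne k\le n\}\ge a_0$. **Matrices $J_0,J_1$.** With the blocks $R_{11}=(r_{jk})_{j,k=1}^m$, $R_{12}=(r_{jk})_{j=1,k=m+1}^{m,n}$, $R_{21}=(r_{jk})_{j=m+1,k=1}^{n,m}$, $R_{22}=(r_{jk})_{j,k=m+1}^n$, $$J_0=\begin{bmatrix}R_{11}&R_{12}\\0&I\end{bmatrix},\qquad J_1=\begin{bmatrix}I&0\\R_{21}&R_{22}\end{bmatrix},$$ where $I$ denotes identity matrices of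 the appropriate sizes ($n-m$ in $J_0$, $m$ in $J_1$). **Generalized solutions and robust exponential stability.** For $s\in\mathbb R$ consider the problem for $t\ge s$ with initial condition $u(x,s)=\varphi(x)$, $x\in[0,1]$. For coefficients in $BC^1(\Pi;\mathbb M_n)$ and $\varphi\in L^2((0,1);\mathbb R^n)$, a function $u\in C([s,\infty);L^2((0,1);\mathbb R^n))$ is an $L^2$-generalized solution if for any sequence $\varphi^l\in C_0^1([0,1];\mathbb R^n)$ with $\varphi^l\to\varphi$ in $L^2$, the sequence $u^l\in C^1([0,1]\times[s,\infty);\mathbb R^n)$ of classical solutions with $\varphi$ replaced by $\varphi^l$ satisfies $\|u(\cdot,\theta)-u^l(\cdot,\theta)\|_{L^2}\to0$ uniformly in $\theta\in[s,s+s_1]$ for every $s_1>0$. (It is known that for coefficients in $BC^1(\Pi;\mathbb M_n)$ satisfying (H) a unique $L^2$-generalized solution exists.) The problem is robust exponentially stable in $L^2$ if there exist $\gamma>0$, $M\ge1$, $\alpha>0$ such that, for all $s\in\mathbb R$, $\varphi\in L^2((0,1);\mathbb R^n)$, and all $\tilde a,\tilde b\in BC^1(\Pi;\mathbb M_n)$, $\tilde a$ diagonal, with $\|\tilde a-a\|_{BC^1(\Pi;\mathbb M_n)}\le\gamma$ and $\|\tilde b-b\|_{BC^1(\Pi;\mathbb M_n)}\le\gamma$ ($\gamma$ being small enough that all such $\tilde a$ satisfy (H) with some positive constant), the $L^2$-generalized solution $\tilde u$ of the initial-boundary value problem with $a,b$ replaced by $\tilde a,\tilde b$ fulfills $\|\tilde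 u(\cdot,t)\|_{L^2((0,1);\mathbb R^n)}\le Me^{-\alpha(t-s)}\|\varphi\|_{L^2((0,1);\mathbb R^n)}$ for all $t\ge s$.
   Formalization: The formal theorem additionally assumes that the partial derivative ∂ₓV is bounded on Π; for V merely continuously differentiable on the non-compact strip, with ∂ₓV unbounded, the claimed uniform robustness can fail. *)

theory Defs
  imports "HOL-Analysis.Analysis"
begin

section \<open>Index set\<close>

text \<open>
  Vectors in \<open>n\<close>-space have type \<open>real^'n\<close> with a finite, linearly ordered index type, so
  \<open>n = CARD('n)\<close>. The components are numbered \<open>1,\<dots>,n\<close> along that order, and the
  condition \<open>j \<le> m\<close> on a component index becomes \<open>pos j \<le> m\<close>.
\<close>

definition pos :: "'n::{finite,linorder} \<Rightarrow> nat" where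
  "pos j = card {i. i \<le> j}"

type_synonym 'n rvec = "(real, 'n) vec"
type_synonym 'n sqmat = "('n rvec, 'n) vec"

section \<open>Continuously differentiable functions\<close>

text \<open>
  Functions of \<open>(x,t)\<close> are curried, space variable first. They are considered on
  \<open>[0,1] \<times> T\<close>, where \<open>T\<close> is the whole line or \<open>[s,\<infinity>)\<close>; the partial derivatives are one-sided
  at the boundary. Values outside \<open>[0,1] \<times> T\<close> never matter.
\<close>

abbreviation strip :: "(real \<times> real) set" where
  "strip \<equiv> {0..1} \<times> UNIV"

definition partial_x :: "(real \<Rightarrow> real \<Rightarrow> 'b::real_normed_vector) \<Rightarrow> real \<Rightarrow> real \<Rightarrow> 'b" where
  "partial_x f x t = vector_derivative (\<lambda>y. f y t) (at x within {0..1})"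

definition partial_t ::
    "real set \<Rightarrow> (real \<Rightarrow> real \<Rightarrow> 'b::real_normed_vector) \<Rightarrow> real \<Rightarrow> real \<Rightarrow> 'b" where
  "partial_t T f x t = vector_derivative (\<lambda>\<tau>. f x \<tau>) (at t within T)"

definition C1_on :: "real set \<Rightarrow> (real \<Rightarrow> real \<Rightarrow> 'b::real_normed_vector) \<Rightarrow> bool" where
  "C1_on T f \<longleftrightarrow>
     (\<forall>x\<in>{0..1}. \<forall>t\<in>T.
        (\<lambda>y. f y t) differentiable (at x within {0..1}) \<and>
        (\<lambda>\<tau>. f x \<tau>) differentiable (at t within T)) \<and>
     continuous_on ({0..1} \<times> T) (\<lambda>(x, t). f x t) \<and>
     continuous_on ({0..1} \<times> T) (\<lambda>(x, t). partial_x f x t) \<and>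
     continuous_on ({0..1} \<times> T) (\<lambda>(x, t). partial_t T f x t)"

definition BC1 :: "(real \<Rightarrow> real \<Rightarrow> 'b::real_normed_vector) \<Rightarrow> bool" where
  "BC1 f \<longleftrightarrow> C1_on UNIV f \<and>
     bounded ((\<lambda>(x, t). f x t) ` strip) \<and>
     bounded ((\<lambda>(x, t). partial_x f x t) ` strip) \<and>
     bounded ((\<lambda>(x, t). partial_t UNIV f x t) ` strip)"

text \<open>
  \<open>infnorm\<close> is the maximum absolute value of the coordinates; on \<open>real^'n^'n\<close> these are the
  matrix entries, so it is the max norm for vectors and for matrices.
\<close>

definition BC1_norm :: "(real \<Rightarrow> real \<Rightarrow> 'b::euclidean_space) \<Rightarrow> real" where
  "BC1_norm f =
     (SUP (x, t)\<in>strip. infnorm (f x t)) +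
     (SUP (x, t)\<in>strip. infnorm (partial_x f x t)) +
     (SUP (x, t)\<in>strip. infnorm (partial_t UNIV f x t))"

definition diagonal_on_strip :: "(real \<Rightarrow> real \<Rightarrow> 'n::finite sqmat) \<Rightarrow> bool" where
  "diagonal_on_strip A \<longleftrightarrow> (\<forall>(x, t)\<in>strip. \<forall>j k. j \<noteq> k \<longrightarrow> A x t $ j $ k = 0)"

text \<open>
  The bounds on infima and suprema are stated pointwise, which is their meaning also when the
  index set is empty (\<open>m = 0\<close> or \<open>m = n\<close>), where the real-valued \<open>Inf\<close> and \<open>Sup\<close> are unspecified.
\<close>

definition hyperbolic :: "nat \<Rightarrow> (real \<Rightarrow> real \<Rightarrow> 'n::{finite,linorder} sqmat) \<Rightarrow> bool" where
  "hyperbolic m a \<longleftrightarrow> (\<exists>a0>0. \<forall>(x, t)\<in>strip.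
     (\<forall>j. pos j \<le> m \<longrightarrow> a x t $ j $ j \<ge> a0) \<and>
     (\<forall>j. m < pos j \<longrightarrow> a x t $ j $ j \<le> - a0) \<and>
     (\<forall>j k. j \<noteq> k \<longrightarrow> \<bar>a x t $ j $ j - a x t $ k $ k\<bar> \<ge> a0))"

section \<open>Boundary operators\<close>

definition bdry_op ::
    "nat \<Rightarrow> 'n::{finite,linorder} sqmat \<Rightarrow> 'n \<Rightarrow> (real \<Rightarrow> 'n rvec) \<Rightarrow> real" where
  "bdry_op m r j v =
     (\<Sum>k | m < pos k. r $ j $ k * v 0 $ k) + (\<Sum>k | pos k \<le> m. r $ j $ k * v 1 $ k)"

definition J0 :: "nat \<Rightarrow> 'n::{finite,linorder} sqmat \<Rightarrow> 'n sqmat" where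
  "J0 m r = (\<chi> j k. if pos j \<le> m then r $ j $ k else mat 1 $ j $ k)"

definition J1 :: "nat \<Rightarrow> 'n::{finite,linorder} sqmat \<Rightarrow> 'n sqmat" where
  "J1 m r = (\<chi> j k. if pos j \<le> m then mat 1 $ j $ k else r $ j $ k)"

section \<open>The space \<open>L\<^sup>2((0,1))\<close> and compactly supported data\<close>

text \<open>Elements of \<open>L\<^sup>2\<close> are represented by functions; all notions below respect a.e. equality.\<close>

definition L2_fun :: "(real \<Rightarrow> real^'n) \<Rightarrow> bool" where
  "L2_fun f \<longleftrightarrow> f \<in> borel_measurable (lebesgue_on {0<..<1}) \<and>
     integrable (lebesgue_on {0<..<1}) (\<lambda>x. (norm (f x))\<^sup>2)"

definition L2_norm :: "(real \<Rightarrow> real^'n) \<Rightarrow> real" where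
  "L2_norm f = sqrt (\<integral>x. (norm (f x))\<^sup>2 \<partial>lebesgue_on {0<..<1})"

definition C01 :: "(real \<Rightarrow> real^'n) \<Rightarrow> bool" where
  "C01 f \<longleftrightarrow> f C1_differentiable_on {0<..<1} \<and>
     (\<exists>K. compact K \<and> K \<subseteq> {0<..<1} \<and> (\<forall>x\<in>{0..1} - K. f x = 0))"

definition continuous_L2_from :: "real \<Rightarrow> (real \<Rightarrow> real \<Rightarrow> real^'n) \<Rightarrow> bool" where
  "continuous_L2_from s u \<longleftrightarrow>
     (\<forall>t\<ge>s. L2_fun (\<lambda>x. u x t)) \<and>
     (\<forall>t\<ge>s. ((\<lambda>\<theta>. L2_norm (\<lambda>x. u x \<theta> - u x t)) \<longlongrightarrow> 0) (at t within {s..}))"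

section \<open>Solutions and stability\<close>

definition classical_solution ::
    "nat \<Rightarrow> 'n::{finite,linorder} sqmat \<Rightarrow> (real \<Rightarrow> real \<Rightarrow> 'n sqmat) \<Rightarrow>
     (real \<Rightarrow> real \<Rightarrow> 'n sqmat) \<Rightarrow> real \<Rightarrow> (real \<Rightarrow> 'n rvec) \<Rightarrow>
     (real \<Rightarrow> real \<Rightarrow> 'n rvec) \<Rightarrow> bool" where
  "classical_solution m r a b s \<phi> u \<longleftrightarrow>
     C1_on {s..} u \<and>
     (\<forall>x\<in>{0<..<1}. \<forall>t\<ge>s.
        partial_t {s..} u x t + a x t *v partial_x u x t + b x t *v u x t = 0) \<and>
     (\<forall>t\<ge>s. \<forall>j. pos j \<le> m \<longrightarrow> u 0 t $ j = bdry_op m r j (\<lambda>x. u x t)) \<and>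
     (\<forall>t\<ge>s. \<forall>j. m < pos j \<longrightarrow> u 1 t $ j = bdry_op m r j (\<lambda>x. u x t)) \<and>
     (\<forall>x\<in>{0..1}. u x s = \<phi> x)"

text \<open>
  ``The sequence of classical solutions'' is read as: for the initial data \<open>\<phi>l l\<close> classical
  solutions exist, and they have the stated convergence property. Without the existence clause,
  every \<open>u\<close> would be a generalized solution of a problem lacking classical solutions.
\<close>

definition L2_generalized_solution ::
    "nat \<Rightarrow> 'n::{finite,linorder} sqmat \<Rightarrow> (real \<Rightarrow> real \<Rightarrow> 'n sqmat) \<Rightarrow>
     (real \<Rightarrow> real \<Rightarrow> 'n sqmat) \<Rightarrow> real \<Rightarrow> (real \<Rightarrow> 'n rvec) \<Rightarrow>
     (real \<Rightarrow> real \<Rightarrow> 'n rvec) \<Rightarrow> bool" where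
  "L2_generalized_solution m r a b s \<phi> u \<longleftrightarrow>
     continuous_L2_from s u \<and>
     (\<forall>\<phi>l :: nat \<Rightarrow> real \<Rightarrow> 'n rvec.
        (\<forall>l. C01 (\<phi>l l)) \<and> (\<lambda>l. L2_norm (\<lambda>x. \<phi>l l x - \<phi> x)) \<longlonglongrightarrow> 0 \<longrightarrow>
        (\<forall>l. \<exists>w. classical_solution m r a b s (\<phi>l l) w) \<and>
        (\<forall>ul. (\<forall>l. classical_solution m r a b s (\<phi>l l) (ul l)) \<longrightarrow>
          (\<forall>s1>0. uniform_limit {s..s + s1}
             (\<lambda>l \<theta>. L2_norm (\<lambda>x. u x \<theta> - ul l x \<theta>)) (\<lambda>_. 0) sequentially)))"

text \<open>
  Existence and uniqueness of the generalized solution under the hyperbolicity condition are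
  background facts, so the decay estimate is required of whatever function is that solution.
\<close>

definition robust_exponentially_stable ::
    "nat \<Rightarrow> 'n::{finite,linorder} sqmat \<Rightarrow> (real \<Rightarrow> real \<Rightarrow> 'n sqmat) \<Rightarrow>
     (real \<Rightarrow> real \<Rightarrow> 'n sqmat) \<Rightarrow> bool" where
  "robust_exponentially_stable m r a b \<longleftrightarrow>
     (\<exists>\<gamma>>0. \<exists>M\<ge>1. \<exists>\<alpha>>0.
        (\<forall>a'. BC1 a' \<and> diagonal_on_strip a' \<and> BC1_norm (\<lambda>x t. a' x t - a x t) \<le> \<gamma> \<longrightarrow>
           hyperbolic m a') \<and>
        (\<forall>s \<phi> a' b' u.
           L2_fun \<phi> \<and>
           BC1 a' \<and> diagonal_on_strip a' \<and> BC1_norm (\<lambda>x t. a' x t - a x t) \<le> \<gamma> \<and>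
           BC1 b' \<and> BC1_norm (\<lambda>x t. b' x t - b x t) \<le> \<gamma> \<and>
           L2_generalized_solution m r a' b' s \<phi> u \<longrightarrow>
           (\<forall>t\<ge>s. L2_norm (\<lambda>x. u x t) \<le> M * exp (- \<alpha> * (t - s)) * L2_norm \<phi>)))"

text \<open>
  A remark on Lyapunov weights \<open>V\<close> for this notion. Replacing \<open>a\<close> by a nearby \<open>a'\<close> perturbs
  \<open>\<partial>\<^sub>x(V a)\<close> by \<open>(\<partial>\<^sub>x V)(a' - a) + V \<partial>\<^sub>x(a' - a)\<close>, so a uniform radius \<open>\<gamma>\<close> needs \<open>\<partial>\<^sub>x V\<close> to
  be bounded on the strip. Boundedness of \<open>V\<close> itself does not give this: the strip is not
  compact, and with \<open>\<partial>\<^sub>x V\<close> unbounded the robustness can fail.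
\<close>

end

theory Submission
  imports Defs "HOL-Real_Asymp.Real_Asymp"
begin

text \<open>
  The energy \<open>E(t) = \<integral> \<langle>V u, u\<rangle> dx\<close> of a classical solution has derivative
  \<open>\<integral> \<langle>(\<partial>\<^sub>tV + \<partial>\<^sub>x(Va) - Vb - b\<^sup>TV) u, u\<rangle> dx\<close> minus the increment of \<open>\<langle>V a u, u\<rangle>\<close> from \<open>x = 0\<close>
  to \<open>x = 1\<close>. The boundary traces are \<open>u(0,t) = J\<^sub>0 w\<close> and \<open>u(1,t) = J\<^sub>1 w\<close>, where \<open>w\<close> collects the
  outgoing components, so that (ii) and (iii) give \<open>E' \<le> - c E\<close>. Both conditions have a margin that
  absorbs small perturbations of \<open>a\<close>, \<open>\<partial>\<^sub>xa\<close> and \<open>b\<close>; here the bounds on \<open>V\<close> and \<open>\<partial>\<^sub>xV\<close> make the radius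
  uniform. The decay passes from classical to generalized solutions because compactly
  supported \<open>C\<^sup>1\<close> data are dense in \<open>L\<^sup>2\<close>.
\<close>

section \<open>The space \<open>L\<^sup>2((0,1))\<close> and density of compactly supported data\<close>

lemma L2_norm_nonneg: "0 \<le> L2_norm f"
  by (simp add: L2_norm_def)

lemma L2_norm_power2: "(L2_norm f)\<^sup>2 = (\<integral>x. (norm (f x))\<^sup>2 \<partial>lebesgue_on {0<..<1})"
  by (simp add: L2_norm_def)

text \<open>Takes the place of the triangle inequality for the L2 norm: it integrates pointwise, at
  the cost of a factor 2 on squared norms that reappears in the final constant.\<close>

lemma norm_diff_power2_le:
  fixes x y :: "'a::real_normed_vector"
  shows "(norm (x - y))\<^sup>2 \<le> 2 * (norm x)\<^sup>2 + 2 * (norm y)\<^sup>2"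
proof -
  have "(norm (x - y))\<^sup>2 \<le> (norm x + norm y)\<^sup>2"
    by (intro power_mono norm_triangle_ineq4) auto
  also have "\<dots> \<le> 2 * (norm x)\<^sup>2 + 2 * (norm y)\<^sup>2"
    using sum_squares_bound[of "norm x" "norm y"] by (simp add: power2_sum)
  finally show ?thesis .
qed

lemma L2_diff:
  assumes "L2_fun f" and "L2_fun g"
  shows L2_fun_diff: "L2_fun (\<lambda>x. f x - g x)"
    and L2_norm_diff_power2_le:
      "(L2_norm (\<lambda>x. f x - g x))\<^sup>2 \<le> 2 * (L2_norm f)\<^sup>2 + 2 * (L2_norm g)\<^sup>2"
proof -
  let ?M = "lebesgue_on {0<..<1::real}"
  have f[measurable]: "f \<in> borel_measurable ?M" and g[measurable]: "g \<in> borel_measurable ?M"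
    and f2: "integrable ?M (\<lambda>x. (norm (f x))\<^sup>2)" and g2: "integrable ?M (\<lambda>x. (norm (g x))\<^sup>2)"
    using assms by (auto simp: L2_fun_def)
  have bound: "integrable ?M (\<lambda>x. 2 * (norm (f x))\<^sup>2 + 2 * (norm (g x))\<^sup>2)"
    using f2 g2 by auto
  have diff2: "integrable ?M (\<lambda>x. (norm (f x - g x))\<^sup>2)"
    by (rule Bochner_Integration.integrable_bound[OF bound])
      (use norm_diff_power2_le[of "f _" "g _"] in auto)
  then show "L2_fun (\<lambda>x. f x - g x)"
    by (simp add: L2_fun_def)
  show "(L2_norm (\<lambda>x. f x - g x))\<^sup>2 \<le> 2 * (L2_norm f)\<^sup>2 + 2 * (L2_norm g)\<^sup>2"
    using integral_mono[OF diff2 bound norm_diff_power2_le] f2 g2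
    by (simp add: L2_norm_power2)
qed

lemma L2_norm_minus_commute: "L2_norm (\<lambda>x. f x - g x) = L2_norm (\<lambda>x. g x - f x)"
  by (simp add: L2_norm_def norm_minus_commute)

lemma L2_norm_power2_le:
  assumes "L2_fun f" and "L2_fun g"
  shows "(L2_norm f)\<^sup>2 \<le> 2 * (L2_norm (\<lambda>x. f x - g x))\<^sup>2 + 2 * (L2_norm g)\<^sup>2"
proof -
  have "L2_fun (\<lambda>x. g x - f x)"
    by (rule L2_fun_diff[OF assms(2,1)])
  from L2_norm_diff_power2_le[OF assms(2) this] show ?thesis
    by (simp add: L2_norm_minus_commute[of f g])
qed

lemma L2_fun_bound:
  assumes f: "f \<in> borel_measurable (lebesgue_on {0<..<1})"
    and w: "integrable (lebesgue_on {0<..<1}) (\<lambda>x. (w x)\<^sup>2)" and le: "\<And>x. norm (f x) \<le> w x"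
  shows "L2_fun f"
  unfolding L2_fun_def
proof
  note [measurable] = f
  show "integrable (lebesgue_on {0<..<1}) (\<lambda>x. (norm (f x))\<^sup>2)"
  proof (rule Bochner_Integration.integrable_bound[OF w])
    show "AE x in lebesgue_on {0<..<1}. norm ((norm (f x))\<^sup>2) \<le> norm ((w x)\<^sup>2)"
      using le by (intro AE_I2) (simp add: power_mono)
  qed measurable
qed (rule f)

lemma finite_measure_unit_interval: "finite_measure (lebesgue_on {0<..<1::real})"
  by (intro finite_measure_lebesgue_on bounded_set_imp_lmeasurable) auto

lemma L2_dominated_convergence:
  fixes f :: "real \<Rightarrow> real^'n"
  assumes f: "f \<in> borel_measurable (lebesgue_on {0<..<1})"
    and g: "\<And>k. g k \<in> borel_measurable (lebesgue_on {0<..<1})"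
    and w: "integrable (lebesgue_on {0<..<1}) (\<lambda>x. (w x)\<^sup>2)"
    and lim: "AE x in lebesgue_on {0<..<1}. (\<lambda>k. g k x) \<longlonglongrightarrow> f x"
    and gw: "\<And>k x. x \<in> {0<..<1} \<Longrightarrow> norm (g k x) \<le> w x"
    and fw: "\<And>x. x \<in> {0<..<1} \<Longrightarrow> norm (f x) \<le> w x"
  shows "(\<lambda>k. L2_norm (\<lambda>x. g k x - f x)) \<longlonglongrightarrow> 0"
proof -
  let ?M = "lebesgue_on {0<..<1::real}"
  note [measurable] = f g
  have "(\<lambda>k. \<integral>x. (norm (g k x - f x))\<^sup>2 \<partial>?M) \<longlonglongrightarrow> (\<integral>x. 0 \<partial>?M)"
  \<comment> \<open>The factor 4 is 2 + 2 from \<open>norm_diff_power2_le\<close>, since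
    \<open>w\<close> dominates both \<open>g k\<close> and \<open>f\<close>.\<close>
  proof (rule integral_dominated_convergence[where w = "\<lambda>x. 4 * (w x)\<^sup>2"])
    show "AE x in ?M. (\<lambda>k. (norm (g k x - f x))\<^sup>2) \<longlonglongrightarrow> 0"
      using lim by eventually_elim (auto intro!: tendsto_eq_intros)
    show "AE x in ?M. norm ((norm (g k x - f x))\<^sup>2) \<le> 4 * (w x)\<^sup>2" for k
    proof (rule AE_I2)
      fix x assume "x \<in> space ?M"
      then have x: "x \<in> {0<..<1}" by simp
      have "(norm (g k x))\<^sup>2 \<le> (w x)\<^sup>2" "(norm (f x))\<^sup>2 \<le> (w x)\<^sup>2"
        using gw[OF x, of k] fw[OF x] by (simp_all add: power_mono)
      then show "norm ((norm (g k x - f x))\<^sup>2) \<le> 4 * (w x)\<^sup>2"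
        using norm_diff_power2_le[of "g k x" "f x"] by simp
    qed
  qed (use w in auto)
  from tendsto_real_sqrt[OF this] show ?thesis
    by (simp add: L2_norm_def)
qed

section \<open>Continuously differentiable cutoffs on the unit interval\<close>

text \<open>Squaring removes the kink of \<open>max 0\<close>: for each of the four sign patterns of
  \<open>z\<close> and \<open>z + h\<close> the first-order remainder is at most h^2, so the error
  of the difference quotient is at most |h|.\<close>

lemma has_real_derivative_pos_part_power2:
  "((\<lambda>z. (max 0 z)\<^sup>2) has_real_derivative 2 * max 0 z) (at z)"
proof -
  have le: "\<bar>(max 0 (z + h))\<^sup>2 - (max 0 z)\<^sup>2 - 2 * max 0 z * h\<bar> \<le> h\<^sup>2" for h :: real
  proof -
    consider "0 \<le> z" "0 \<le> z + h" | "0 \<le> z" "z + h < 0" | "z < 0" "0 \<le> z + h" | "z < 0" "z + h < 0"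
      by linarith
    then show ?thesis
    proof cases
      case 2
      have "z * h \<le> - z\<^sup>2" using mult_left_mono[of h "-z" z] 2 by (simp add: power2_eq_square)
      moreover have "0 \<le> (z + h)\<^sup>2" "0 \<le> z\<^sup>2" "0 \<le> h\<^sup>2" by simp_all
      moreover have "(z + h)\<^sup>2 = z\<^sup>2 + 2 * (z * h) + h\<^sup>2" by (simp add: power2_sum)
      ultimately have "\<bar>0 - z\<^sup>2 - 2 * (z * h)\<bar> \<le> h\<^sup>2" by linarith
      then show ?thesis using 2 by (simp add: max_def mult.assoc)
    next
      case 3
      then have "(z + h)\<^sup>2 \<le> h\<^sup>2" by (intro power_mono) auto
      then show ?thesis using 3 by (simp add: max_def)
    qed (auto simp: max_def power2_eq_square algebra_simps)
  qed
  have "((\<lambda>h. ((max 0 (z + h))\<^sup>2 - (max 0 z)\<^sup>2) / h - 2 * max 0 z) \<longlongrightarrow> 0) (at 0)"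
  proof (rule Lim_null_comparison)
    show "\<forall>\<^sub>F h in at 0. norm (((max 0 (z + h))\<^sup>2 - (max 0 z)\<^sup>2) / h - 2 * max 0 z) \<le> \<bar>h\<bar>"
    proof (intro eventually_at_topological[THEN iffD2] exI[of _ UNIV] conjI ballI impI)
      fix h :: real assume h: "h \<noteq> 0"
      have "\<bar>((max 0 (z + h))\<^sup>2 - (max 0 z)\<^sup>2) / h - 2 * max 0 z\<bar>
          = \<bar>(max 0 (z + h))\<^sup>2 - (max 0 z)\<^sup>2 - 2 * max 0 z * h\<bar> / \<bar>h\<bar>"
        using h by (simp add: field_simps flip: abs_divide)
      also have "\<dots> \<le> h\<^sup>2 / \<bar>h\<bar>"
        by (intro divide_right_mono le) simp
      also have "\<dots> = \<bar>h\<bar>"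
        using h by (simp add: divide_eq_eq power2_eq_square)
      finally show "norm (((max 0 (z + h))\<^sup>2 - (max 0 z)\<^sup>2) / h - 2 * max 0 z) \<le> \<bar>h\<bar>"
        by simp
    qed auto
    show "((\<lambda>h::real. \<bar>h\<bar>) \<longlongrightarrow> 0) (at 0)"
      by (intro tendsto_eq_intros) auto
  qed
  then show ?thesis
    unfolding DERIV_def by (rule LIM_zero_cancel)
qed

text \<open>Put q = max 0 (k x (1 - x) - 1). It vanishes near both endpoints, its square is
  continuously differentiable, and q^2 / (1 + q^2) stays below 1. As k grows, q tends to infinity at
  every interior point, so the values tend to 1 there.\<close>

definition cutoff :: "nat \<Rightarrow> real \<Rightarrow> real" where
  "cutoff k x = (max 0 (k * (x * (1 - x)) - 1))\<^sup>2 / (1 + (max 0 (k * (x * (1 - x)) - 1))\<^sup>2)"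

lemma cutoff_C1: "cutoff k C1_differentiable_on S"
proof -
  define q where "q x = max 0 (real k * (x * (1 - x)) - 1)" for x
  define Q where "Q x = (q x)\<^sup>2" for x
  let ?d = "\<lambda>x. 2 * q x * (real k * (1 - 2 * x))"
  have cq: "continuous_on S q"
    unfolding q_def by (intro continuous_intros)
  have cQ: "continuous_on S Q"
    unfolding Q_def by (intro continuous_intros cq)
  have nz: "1 + Q x \<noteq> 0" for x
    using zero_le_power2[of "q x"] by (simp add: Q_def add_nonneg_eq_0_iff)
  have Q: "(Q has_real_derivative ?d x) (at x)" for x
    unfolding q_def Q_def
    by (rule DERIV_chain2[OF has_real_derivative_pos_part_power2])
      (auto intro!: derivative_eq_intros simp: algebra_simps)
  have "((\<lambda>x. Q x / (1 + Q x)) has_real_derivative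
      (?d x * (1 + Q x) - Q x * ?d x) / ((1 + Q x) * (1 + Q x))) (at x)" for x
    by (rule derivative_eq_intros Q nz refl)+ simp
  moreover have "continuous_on S (\<lambda>x. (?d x * (1 + Q x) - Q x * ?d x) / ((1 + Q x) * (1 + Q x)))"
    using nz by (intro continuous_intros cq cQ) auto
  ultimately have "(\<lambda>x. Q x / (1 + Q x)) C1_differentiable_on S"
    unfolding C1_differentiable_on_def
    by (intro exI[of _ "\<lambda>x. (?d x * (1 + Q x) - Q x * ?d x) / ((1 + Q x) * (1 + Q x))"])
      (auto simp: has_real_derivative_iff_has_vector_derivative)
  then show ?thesis
    by (simp add: cutoff_def[abs_def] Q_def q_def)
qed

lemma cutoff_bounds: "0 \<le> cutoff k x" "cutoff k x \<le> 1"
  by (simp_all add: cutoff_def divide_simps add_pos_nonneg)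

lemma cutoff_tendsto:
  assumes "x \<in> {0<..<1}"
  shows "(\<lambda>k. cutoff k x) \<longlonglongrightarrow> 1"
proof -
  have "0 < x * (1 - x)" using assms by simp
  then have "filterlim (\<lambda>k. real k * (x * (1 - x)) - 1) at_top sequentially"
    by real_asymp
  then have "filterlim (\<lambda>k. max 0 (real k * (x * (1 - x)) - 1)) at_top sequentially"
    by (rule filterlim_at_top_mono) auto
  moreover have "((\<lambda>q::real. q\<^sup>2 / (1 + q\<^sup>2)) \<longlongrightarrow> 1) at_top"
    by real_asymp
  ultimately show ?thesis
    unfolding cutoff_def by (rule filterlim_compose[rotated])
qed

lemma cutoff_support: "\<exists>K. compact K \<and> K \<subseteq> {0<..<1} \<and> (\<forall>x\<in>{0..1} - K. cutoff k x = 0)"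
proof (intro exI conjI)
  \<comment> \<open>Since \<open>x * (1 - x)\<close> vanishes at 0 and 1, this closed condition
    excludes both endpoints; off \<open>?K\<close> the positive part is zero.\<close>
  let ?K = "{0..1} \<inter> {x. 1 \<le> real k * (x * (1 - x))}"
  show "compact ?K"
    by (intro compact_Int_closed closed_Collect_le continuous_intros) auto
  show "?K \<subseteq> {0<..<1}"
  proof
    fix x assume x: "x \<in> ?K"
    then have "x \<noteq> 0" "x \<noteq> 1" by auto
    then show "x \<in> {0<..<1}" using x by auto
  qed
  show "\<forall>x\<in>{0..1} - ?K. cutoff k x = 0"
    by (auto simp: cutoff_def)
qed

text \<open>
  Truncation to the ball of radius \<open>N \<ge> 1\<close>. A rational formula is used so that polynomials stay
  continuously differentiable after truncation.
\<close>

definition clip :: "real \<Rightarrow> 'a::real_inner \<Rightarrow> 'a" where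
  "clip N y = (1 / (1 + (y \<bullet> y) / N)) *\<^sub>R y"

lemma clip_denom_pos:
  fixes y :: "'a::real_inner"
  shows "0 < N \<Longrightarrow> 0 < 1 + (y \<bullet> y) / N"
  by (simp add: add_pos_nonneg)

lemma norm_clip_le_norm:
  assumes "0 < N" shows "norm (clip N y) \<le> norm y"
proof -
  have "\<bar>1 / (1 + (y \<bullet> y) / N)\<bar> \<le> 1"
    using assms clip_denom_pos[OF assms, of y] by (simp add: divide_simps)
  then show ?thesis
    unfolding clip_def norm_scaleR by (metis mult_left_le_one_le abs_ge_zero norm_ge_zero)
qed

text \<open>The bound amounts to \<open>norm y \<le> N + (norm y)\<^sup>2\<close>. For
  \<open>norm y \<le> 1\<close> it follows from \<open>1 \<le> N\<close>, and otherwise the square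
  alone is large enough.\<close>

lemma norm_clip_le:
  assumes "1 \<le> N" shows "norm (clip N y) \<le> N"
proof -
  have pos: "0 < 1 + (y \<bullet> y) / N" using assms by (intro clip_denom_pos) auto
  have "norm y \<le> N + (norm y)\<^sup>2"
  proof (cases "norm y \<le> 1")
    case False
    then show ?thesis
      using assms mult_left_mono[of 1 "norm y" "norm y"] by (simp add: power2_eq_square)
  qed (use assms in \<open>auto intro: add_increasing2\<close>)
  also have "\<dots> = N * (1 + (y \<bullet> y) / N)"
    using assms by (simp add: power2_norm_eq_inner field_simps)
  finally show ?thesis
    using pos by (simp add: clip_def divide_simps)
qed

lemma continuous_clip: "0 < N \<Longrightarrow> continuous_on S (clip N)"
  unfolding clip_def
  by (intro continuous_intros) (use clip_denom_pos[of N] in \<open>force simp: less_le\<close>)+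

lemma clip_tendsto: "(\<lambda>k. clip (real (Suc k)) y) \<longlonglongrightarrow> y"
proof -
  have "(\<lambda>k. 1 / (1 + (y \<bullet> y) / real (Suc k))) \<longlonglongrightarrow> 1"
    by real_asymp
  from tendsto_scaleR[OF this tendsto_const[of y]] show ?thesis
    by (simp add: clip_def)
qed

text \<open>The denominator never vanishes and depends on \<open>p\<close> only through
  \<open>p x \<bullet> p x\<close>, so the quotient rule gives a continuous derivative.\<close>

lemma clip_polynomial_C1:
  fixes p :: "real \<Rightarrow> 'a::euclidean_space"
  assumes "polynomial_function p" and "0 < N"
  shows "(\<lambda>x. clip N (p x)) C1_differentiable_on S"
proof -
  obtain p' where p': "polynomial_function p'" "\<And>x. (p has_vector_derivative p' x) (at x)"
    using has_vector_derivative_polynomial_function[OF assms(1)] by blast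
  have cont: "continuous_on S p" "continuous_on S p'"
    using assms(1) p'(1) continuous_on_polymonial_function by auto
  have p: "p C1_differentiable_on S"
    using p'(2) cont by (auto simp: C1_differentiable_on_def)
  let ?c = "\<lambda>x. 1 + (p x \<bullet> p x) / N"
  have nz: "?c x \<noteq> 0" for x
    using clip_denom_pos[OF assms(2), of "p x"] by simp
  have pp: "((\<lambda>x. p x \<bullet> p x) has_real_derivative p x \<bullet> p' x + p' x \<bullet> p x) (at x)" for x
    using bounded_bilinear.has_vector_derivative[OF bounded_bilinear_inner p'(2) p'(2)]
    by (simp add: has_real_derivative_iff_has_vector_derivative)
  have "((\<lambda>x. 1 / ?c x) has_real_derivative - ((p x \<bullet> p' x + p' x \<bullet> p x) / N) / (?c x * ?c x)) (at x)" for x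
    by (rule derivative_eq_intros pp nz refl)+ (use assms nz in auto)
  moreover have "continuous_on S (\<lambda>x. - ((p x \<bullet> p' x + p' x \<bullet> p x) / N) / (?c x * ?c x))"
    using nz assms by (intro continuous_intros cont) auto
  ultimately have "(\<lambda>x. 1 / ?c x) C1_differentiable_on S"
    unfolding C1_differentiable_on_def
    by (intro exI[of _ "\<lambda>x. - ((p x \<bullet> p' x + p' x \<bullet> p x) / N) / (?c x * ?c x)"])
      (simp add: has_real_derivative_iff_has_vector_derivative)
  from C1_differentiable_on_scaleR[OF this p] show ?thesis
    by (simp add: clip_def)
qed

section \<open>Polynomial approximation and density\<close>

lemma continuous_on_unit_interval_measurable:
  fixes f :: "real \<Rightarrow> real^'n"
  assumes "continuous_on {0<..<1} f"
  shows "f \<in> borel_measurable (lebesgue_on {0<..<1})"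
  using assms by (intro continuous_imp_measurable_on_sets_lebesgue) auto

text \<open>Measurability provides continuous functions converging off a null set. Weierstrass
  replaces the k-th of them by a polynomial with uniform error below 1/(k+1) on
  \<open>{0..1}\<close>, which does not affect the limit.\<close>

lemma measurable_approx_polynomial:
  fixes f :: "real \<Rightarrow> real^'n"
  assumes "f \<in> borel_measurable (lebesgue_on {0<..<1})"
  obtains p where "\<And>k. polynomial_function (p k)"
    and "AE x in lebesgue_on {0<..<1}. (\<lambda>k. p k x) \<longlonglongrightarrow> f x"
proof -
  have "f measurable_on {0<..<1}"
    using assms by (subst measurable_on_iff_borel_measurable) auto
  then obtain N g where N: "negligible N" and g: "\<And>k::nat. continuous_on UNIV (g k)"
    and lim: "\<And>x. x \<notin> N \<Longrightarrow> (\<lambda>k. g k x) \<longlonglongrightarrow> (if x \<in> {0<..<1} then f x else 0)"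
    unfolding measurable_on_def by blast
  have "\<exists>p. polynomial_function p \<and> (\<forall>x\<in>{0..1}. norm (g k x - p x) < inverse (real (Suc k)))" for k
    by (intro Stone_Weierstrass_polynomial_function) (auto intro: continuous_on_subset[OF g])
  then obtain p where p: "\<And>k. polynomial_function (p k)"
    and gp: "\<And>k x. x \<in> {0..1} \<Longrightarrow> norm (g k x - p k x) < inverse (real (Suc k))"
    by metis
  have "AE x in lebesgue_on {0<..<1}. x \<notin> N"
    using N AE_not_in[of N lebesgue]
    by (auto simp: AE_restrict_space_iff negligible_iff_null_sets elim: eventually_mono)
  then have "AE x in lebesgue_on {0<..<1}. (\<lambda>k. p k x) \<longlonglongrightarrow> f x"
    using AE_space
  proof eventually_elim
    case (elim x)
    then have x: "x \<in> {0<..<1}" by simp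
    have "(\<lambda>k. g k x - p k x) \<longlonglongrightarrow> 0"
      by (rule Lim_null_comparison[OF _ LIMSEQ_inverse_real_of_nat])
        (use gp[of x] x in \<open>auto intro!: always_eventually less_imp_le\<close>)
    from tendsto_diff[OF lim[OF elim(1)] this] show ?case
      using x by simp
  qed
  with p show ?thesis by (rule that)
qed

text \<open>Two approximations are combined. The truncations \<open>clip (N l) (f x)\<close> tend to
  \<open>f\<close>, dominated by \<open>norm (f x)\<close>; for fixed \<open>l\<close> they are
  themselves limits of cutoffs times truncated polynomials, dominated by the constant
  \<open>N l\<close>.\<close>

lemma C01_dense_L2:
  fixes f :: "real \<Rightarrow> real^'n"
  assumes "L2_fun f"
  obtains g where "\<And>l::nat. C01 (g l)" and "(\<lambda>l. L2_norm (\<lambda>x. g l x - f x)) \<longlonglongrightarrow> 0"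
proof -
  let ?M = "lebesgue_on {0<..<1::real}"
  have f[measurable]: "f \<in> borel_measurable ?M" and f2: "integrable ?M (\<lambda>x. (norm (f x))\<^sup>2)"
    using assms by (auto simp: L2_fun_def)
  obtain p where p: "\<And>k. polynomial_function (p k)"
    and plim: "AE x in ?M. (\<lambda>k. p k x) \<longlonglongrightarrow> f x"
    by (rule measurable_approx_polynomial[OF f]) blast
  define N where "N l = real (Suc l)" for l
  have N1: "1 \<le> N l" "0 < N l" for l
    by (auto simp: N_def)
  define h where "h l k x = cutoff k x *\<^sub>R clip (N l) (p k x)" for l k x
  have clip_meas[measurable]: "(clip (N l) :: real^'n \<Rightarrow> _) \<in> borel_measurable borel" for l
    by (intro borel_measurable_continuous_onI continuous_clip N1)
  have C1: "h l k C1_differentiable_on UNIV" for l k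
    unfolding h_def by (intro C1_differentiable_on_scaleR cutoff_C1 clip_polynomial_C1 p N1)
  have h_C01: "C01 (h l k)" for l k
    unfolding C01_def
  proof
    show "h l k C1_differentiable_on {0<..<1}"
      using C1 by (rule C1_differentiable_on_subset) auto
    show "\<exists>K. compact K \<and> K \<subseteq> {0<..<1} \<and> (\<forall>x\<in>{0..1} - K. h l k x = 0)"
      using cutoff_support[of k] by (fastforce simp: h_def)
  qed
  have h_meas[measurable]: "h l k \<in> borel_measurable ?M" for l k
    using C1 by (intro continuous_on_unit_interval_measurable differentiable_imp_continuous_on C1_diff_imp_diff)
      (auto intro: C1_differentiable_on_subset)
  have const: "integrable ?M (\<lambda>x. (N l)\<^sup>2)" for l
    using finite_measure.integrable_const[OF finite_measure_unit_interval] .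
  have h_le: "norm (h l k x) \<le> N l" for l k x
    using cutoff_bounds[of k x] norm_clip_le[OF N1(1), of l "p k x"]
      mult_mono[of "cutoff k x" 1 "norm (clip (N l) (p k x))" "N l"]
    by (simp add: h_def)
  \<comment> \<open>Truncation makes the dominating function constant, hence square integrable on
    the unit interval; the polynomials \<open>p k\<close> themselves need not have a common
    bound.\<close>
  have h_lim: "(\<lambda>k. L2_norm (\<lambda>x. h l k x - clip (N l) (f x))) \<longlonglongrightarrow> 0" for l
  proof (rule L2_dominated_convergence[where w = "\<lambda>x. N l"])
    show "AE x in ?M. (\<lambda>k. h l k x) \<longlonglongrightarrow> clip (N l) (f x)"
      using plim AE_space
    proof eventually_elim
      case (elim x)
      have "(\<lambda>k. clip (N l) (p k x)) \<longlonglongrightarrow> clip (N l) (f x)"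
        using continuous_on_tendsto_compose[OF continuous_clip[OF N1(2), of UNIV] elim(1)] by auto
      from tendsto_scaleR[OF cutoff_tendsto this] elim(2) show ?case
        by (simp add: h_def)
    qed
  qed (use const h_le norm_clip_le[OF N1(1)] in auto)
  \<comment> \<open>Diagonal choice: for each \<open>l\<close> an index \<open>k l\<close> is fixed
    whose inner error is below 1/(l+1).\<close>
  have "\<exists>k. L2_norm (\<lambda>x. h l k x - clip (N l) (f x)) < inverse (N l)" for l
    using LIMSEQ_D[OF h_lim, of "inverse (N l)" l] N1(2)[of l]
    by (auto simp: L2_norm_nonneg)
  then obtain k where k: "\<And>l. L2_norm (\<lambda>x. h l (k l) x - clip (N l) (f x)) < inverse (N l)"
    by metis
  have clip_lim: "(\<lambda>l. L2_norm (\<lambda>x. clip (N l) (f x) - f x)) \<longlonglongrightarrow> 0"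
  proof (rule L2_dominated_convergence[where w = "\<lambda>x. norm (f x)"])
    show "(\<lambda>x. clip (N k) (f x)) \<in> borel_measurable ?M" for k
      by measurable
    show "AE x in ?M. (\<lambda>k. clip (N k) (f x)) \<longlonglongrightarrow> f x"
      unfolding N_def by (rule AE_I2) (rule clip_tendsto)
  qed (intro f f2 norm_clip_le_norm N1 order_refl)+
  have clip_L2: "L2_fun (\<lambda>x. clip (N l) (f x))" for l
    by (rule L2_fun_bound[OF _ f2]) (measurable, rule norm_clip_le_norm[OF N1(2)])
  have h_L2: "L2_fun (h l k)" for l k
    by (rule L2_fun_bound[OF h_meas const h_le])
  have "(\<lambda>l. (L2_norm (\<lambda>x. h l (k l) x - f x))\<^sup>2) \<longlonglongrightarrow> 0"
  proof (rule tendsto_sandwich[where f = "\<lambda>_. 0"])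
    show "\<forall>\<^sub>F l in sequentially. (L2_norm (\<lambda>x. h l (k l) x - f x))\<^sup>2
        \<le> 2 * (inverse (N l))\<^sup>2 + 2 * (L2_norm (\<lambda>x. clip (N l) (f x) - f x))\<^sup>2"
    proof (intro always_eventually allI)
      fix l
      have "(L2_norm (\<lambda>x. h l (k l) x - f x))\<^sup>2
          \<le> 2 * (L2_norm (\<lambda>x. h l (k l) x - clip (N l) (f x)))\<^sup>2
            + 2 * (L2_norm (\<lambda>x. clip (N l) (f x) - f x))\<^sup>2"
        using L2_norm_power2_le[OF L2_fun_diff[OF h_L2[of l "k l"] assms] L2_fun_diff[OF clip_L2[of l] assms]]
        by simp
      moreover have "(L2_norm (\<lambda>x. h l (k l) x - clip (N l) (f x)))\<^sup>2 \<le> (inverse (N l))\<^sup>2"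
        using k[of l] by (intro power_mono L2_norm_nonneg) auto
      ultimately show "(L2_norm (\<lambda>x. h l (k l) x - f x))\<^sup>2
          \<le> 2 * (inverse (N l))\<^sup>2 + 2 * (L2_norm (\<lambda>x. clip (N l) (f x) - f x))\<^sup>2"
        by linarith
    qed
    have "(\<lambda>l. inverse (N l)) \<longlonglongrightarrow> 0"
      unfolding N_def by (rule LIMSEQ_inverse_real_of_nat)
    from tendsto_add[OF tendsto_mult_right_zero[OF tendsto_null_power[OF this, of 2], of 2]
        tendsto_mult_right_zero[OF tendsto_null_power[OF clip_lim, of 2], of 2]]
    show "(\<lambda>l. 2 * (inverse (N l))\<^sup>2 + 2 * (L2_norm (\<lambda>x. clip (N l) (f x) - f x))\<^sup>2) \<longlonglongrightarrow> 0"
      by simp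
  qed auto
  from tendsto_real_sqrt[OF this] have lim: "(\<lambda>l. L2_norm (\<lambda>x. h l (k l) x - f x)) \<longlonglongrightarrow> 0"
    by (simp add: L2_norm_nonneg)
  show ?thesis
  proof (rule that)
    show "C01 (h l (k l))" for l
      by (rule h_C01)
  qed (rule lim)
qed

text \<open>Links the Lebesgue integral on the open interval, used in \<open>L2_norm\<close>, with
  the gauge integral on the closed one, where differentiation under the integral and the fundamental
  theorem of calculus are applied.\<close>

lemma continuous_L2:
  fixes f :: "real \<Rightarrow> real^'n"
  assumes "continuous_on {0..1} f"
  shows continuous_imp_L2_fun: "L2_fun f"
    and continuous_L2_norm_power2: "(L2_norm f)\<^sup>2 = integral {0..1} (\<lambda>x. (norm (f x))\<^sup>2)"
proof -
  have "(\<lambda>x. (norm (f x))\<^sup>2) absolutely_integrable_on {0..1}"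
    by (intro absolutely_integrable_continuous_real continuous_intros assms)
  then have "(\<lambda>x. (norm (f x))\<^sup>2) absolutely_integrable_on {0<..<1}"
    by (rule set_integrable_subset) auto
  then have "integrable (lebesgue_on {0<..<1}) (\<lambda>x. (norm (f x))\<^sup>2)"
    by (rule absolutely_integrable_imp_integrable) auto
  moreover have "f \<in> borel_measurable (lebesgue_on {0<..<1})"
    by (intro continuous_on_unit_interval_measurable continuous_on_subset[OF assms]) auto
  ultimately show "L2_fun f" "(L2_norm f)\<^sup>2 = integral {0..1} (\<lambda>x. (norm (f x))\<^sup>2)"
    by (simp_all add: L2_fun_def L2_norm_power2 lebesgue_integral_eq_integral integral_open_interval_real)
qed

lemma L2_norm_cong: "(\<And>x. x \<in> {0<..<1} \<Longrightarrow> f x = g x) \<Longrightarrow> L2_norm f = L2_norm g"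
  unfolding L2_norm_def by (intro arg_cong[where f = sqrt] Bochner_Integration.integral_cong) auto

section \<open>Matrices and quadratic forms\<close>

text \<open>Here \<open>norm A\<close> is the Frobenius norm, the Euclidean norm of the vector of
  row norms, so Cauchy-Schwarz in each row suffices.\<close>

lemma norm_matrix_vector_mult_le:
  fixes A :: "real^'n^'m"
  shows "norm (A *v x) \<le> norm A * norm x"
proof -
  have "norm (A *v x) \<le> L2_set (\<lambda>i. norm (A $ i) * norm x) UNIV"
    unfolding norm_vec_def[of "A *v x"]
    by (intro L2_set_mono) (auto simp: matrix_vector_mul_component Cauchy_Schwarz_ineq2)
  also have "\<dots> = norm A * norm x"
    by (simp add: norm_vec_def[of A] L2_set_left_distrib)
  finally show ?thesis .
qed

lemma bounded_bilinear_matrix_vector_mult: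
  "bounded_bilinear ((*v) :: real^'n^'m \<Rightarrow> real^'n \<Rightarrow> real^'m)"
proof
  show "\<exists>K. \<forall>(A::real^'n^'m) x. norm (A *v x) \<le> norm A * norm x * K"
    using norm_matrix_vector_mult_le by (intro exI[of _ 1]) auto
qed (simp_all add: algebra_simps scaleR_matrix_vector_assoc)

lemma bounded_bilinear_matrix_matrix_mult:
  "bounded_bilinear ((**) :: real^'n^'m \<Rightarrow> real^'p^'n \<Rightarrow> real^'p^'m)"
  unfolding bilinear_conv_bounded_bilinear[symmetric] bilinear_def
  by (auto intro!: linearI simp: vec_eq_iff matrix_matrix_mult_def sum_distrib_left
      distrib_left distrib_right sum.distrib mult.assoc mult.left_commute)

section \<open>Quadratic forms of matrices\<close>

definition qform :: "real^'n^'n \<Rightarrow> real^'n \<Rightarrow> real" where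
  "qform A v = (A *v v) \<bullet> v"

lemma qform_add: "qform (A + B) v = qform A v + qform B v"
  by (simp add: qform_def algebra_simps inner_left_distrib)

lemma qform_diff: "qform (A - B) v = qform A v - qform B v"
  by (simp add: qform_def algebra_simps inner_diff_left)

lemma qform_transpose: "qform (transpose A) v = qform A v"
  by (metis dot_lmul_matrix inner_commute qform_def transpose_matrix_vector)

text \<open>Turns the matrix of condition (iii) into forms evaluated at the boundary traces
  \<open>J *v v\<close>.\<close>

lemma qform_congruence: "qform (transpose J ** A ** J) v = qform A (J *v v)"
  by (metis dot_lmul_matrix matrix_vector_mul_assoc qform_def transpose_matrix_vector)

lemma symmetric_matrix_inner:
  fixes A :: "real^'n^'n"
  assumes "transpose A = A"
  shows "(A *v x) \<bullet> y = x \<bullet> (A *v y)"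
  by (metis assms dot_lmul_matrix transpose_matrix_vector)

text \<open>The product rule yields two terms containing \<open>v'\<close>; symmetry of
  \<open>A x\<close> makes them equal, whence the factor 2.\<close>

lemma qform_has_vector_derivative:
  assumes A: "(A has_vector_derivative A') (at x within S)" and sym: "transpose (A x) = A x"
    and v: "(v has_vector_derivative v') (at x within S)"
  shows "((\<lambda>y. qform (A y) (v y)) has_real_derivative qform A' (v x) + 2 * ((A x *v v x) \<bullet> v'))
    (at x within S)"
proof -
  have "(A x *v v') \<bullet> v x = (A x *v v x) \<bullet> v'"
    by (metis dot_lmul_matrix inner_commute sym transpose_matrix_vector)
  with bounded_bilinear.has_vector_derivative[OF bounded_bilinear_inner
      bounded_bilinear.has_vector_derivative[OF bounded_bilinear_matrix_vector_mult A v] v]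
  show ?thesis
    by (simp add: has_real_derivative_iff_has_vector_derivative qform_def inner_left_distrib add.commute)
qed

lemma continuous_on_qform [continuous_intros]:
  assumes "continuous_on S A" and "continuous_on S v"
  shows "continuous_on S (\<lambda>x. qform (A x) (v x))"
  unfolding qform_def
  by (intro continuous_intros bounded_bilinear.continuous_on[OF bounded_bilinear_matrix_vector_mult] assms)

section \<open>Max norm, diagonal matrices and Euclidean bounds\<close>

lemma matrix_component_le_infnorm: "\<bar>A $ i $ j\<bar> \<le> infnorm (A :: real^'n^'m)"
  using Basis_le_infnorm[of "axis i (axis j 1)" A] by (auto simp: inner_axis axis_in_Basis_iff)

lemma infnorm_matrix_le:
  fixes A :: "real^'n^'m"
  assumes "\<And>i j. \<bar>A $ i $ j\<bar> \<le> c"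
  shows "infnorm A \<le> c"
  unfolding infnorm_Max using assms
  by (auto simp: Basis_vec_def inner_axis)

text \<open>Ensures that the suprema in \<open>BC1_norm\<close> are taken over bounded sets, so that
  they are upper bounds of the values.\<close>

lemma bounded_imp_bdd_above_infnorm:
  fixes f :: "'a \<Rightarrow> 'b::euclidean_space"
  assumes "bounded (f ` S)"
  shows "bdd_above ((\<lambda>z. infnorm (f z)) ` S)"
  using assms infnorm_le_norm order_trans unfolding bounded_iff bdd_above_def by blast

lemma diagonal_symmetric:
  fixes A :: "real^'n^'n"
  assumes "\<And>j k. j \<noteq> k \<Longrightarrow> A $ j $ k = 0"
  shows "transpose A = A"
proof -
  have "A $ j $ k = A $ k $ j" for j k
    by (cases "j = k") (simp_all add: assms)
  then show ?thesis
    by (simp add: vec_eq_iff transpose_def)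
qed

text \<open>A product of diagonal matrices is diagonal. For \<open>V\<close> and the speeds this
  gives the symmetry that lets the transport term be integrated by parts.\<close>

lemma diagonal_mult_symmetric:
  fixes A B :: "real^'n^'n"
  assumes "\<And>j k. j \<noteq> k \<Longrightarrow> A $ j $ k = 0" and "\<And>j k. j \<noteq> k \<Longrightarrow> B $ j $ k = 0"
  shows "transpose (A ** B) = A ** B"
proof (rule diagonal_symmetric)
  fix j k :: 'n assume "j \<noteq> k"
  then have "A $ j $ i * B $ i $ k = 0" for i
    using assms by (cases "i = j") auto
  from sum.neutral[OF ballI[OF this]] show "(A ** B) $ j $ k = 0"
    by (simp add: matrix_matrix_mult_def)
qed

lemma abs_qform_mult_le: "\<bar>qform (A ** B) v\<bar> \<le> norm A * norm B * (norm v)\<^sup>2"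
proof -
  have "\<bar>qform (A ** B) v\<bar> \<le> norm (A *v (B *v v)) * norm v"
    unfolding qform_def matrix_vector_mul_assoc[symmetric] by (rule Cauchy_Schwarz_ineq2)
  also have "\<dots> \<le> (norm A * (norm B * norm v)) * norm v"
    by (intro mult_right_mono order_trans[OF norm_matrix_vector_mult_le] mult_left_mono
        norm_matrix_vector_mult_le) auto
  finally show ?thesis by (simp add: power2_eq_square mult.assoc)
qed

text \<open>Bridges the Lyapunov conditions, stated in the max norm, and the L2 norm, built on the
  Euclidean norm.\<close>

lemma norm_power2_le_infnorm:
  fixes v :: "real^'n"
  shows "(norm v)\<^sup>2 \<le> real CARD('n) * (infnorm v)\<^sup>2"
proof -
  have "(norm v)\<^sup>2 \<le> (sqrt (real CARD('n)) * infnorm v)\<^sup>2"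
    using norm_le_infnorm[of v] by (intro power_mono) auto
  then show ?thesis by (simp add: power_mult_distrib)
qed

lemma infnorm_power2_le: "(infnorm v)\<^sup>2 \<le> (norm v)\<^sup>2"
  by (intro power_mono infnorm_le_norm infnorm_pos_le)

section \<open>Partial derivatives on the strip\<close>

lemma C1_on_partial_x:
  assumes "C1_on T f" and "x \<in> {0..1}" and "t \<in> T"
  shows "((\<lambda>y. f y t) has_vector_derivative partial_x f x t) (at x within {0..1})"
  using assms unfolding C1_on_def partial_x_def by (simp add: vector_derivative_works)

lemma C1_on_partial_t:
  assumes "C1_on T f" and "x \<in> {0..1}" and "t \<in> T"
  shows "((\<lambda>\<tau>. f x \<tau>) has_vector_derivative partial_t T f x t) (at t within T)"
  using assms unfolding C1_on_def partial_t_def by (simp add: vector_derivative_works)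

lemma partial_x_eqI:
  assumes "((\<lambda>y. f y t) has_vector_derivative f') (at x within {0..1})" and "x \<in> {0..1}"
  shows "partial_x f x t = f'"
  using assms unfolding partial_x_def
  by (intro vector_derivative_within_cbox[of 0 1, simplified]) auto

lemma partial_t_eqI:
  assumes "((\<lambda>\<tau>. f x \<tau>) has_vector_derivative f') (at t)"
  shows "partial_t UNIV f x t = f'"
  using assms unfolding partial_t_def by (rule vector_derivative_at)

lemma continuous_on_curried:
  assumes "continuous_on ({0..1} \<times> T) (\<lambda>(x, t). f x t)"
    and "continuous_on S g" and "continuous_on S h" and "\<And>z. z \<in> S \<Longrightarrow> g z \<in> {0..1} \<and> h z \<in> T"
  shows "continuous_on S (\<lambda>z. f (g z) (h z))"
proof -
  have "continuous_on S (\<lambda>z. (\<lambda>(x, t). f x t) (g z, h z))"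
    by (rule continuous_on_compose2[OF assms(1)]) (use assms in \<open>auto intro!: continuous_intros\<close>)
  then show ?thesis by simp
qed

text \<open>The maps \<open>g\<close> and \<open>h\<close> are arbitrary so that the same facts
  serve slices at fixed time and joint continuity with the variables in the order (t, x), as
  differentiation under the integral requires.\<close>

lemma C1_on_continuous:
  assumes "C1_on T f"
    and "continuous_on S g" and "continuous_on S h" and "\<And>z. z \<in> S \<Longrightarrow> g z \<in> {0..1} \<and> h z \<in> T"
  shows "continuous_on S (\<lambda>z. f (g z) (h z))"
    and "continuous_on S (\<lambda>z. partial_x f (g z) (h z))"
    and "continuous_on S (\<lambda>z. partial_t T f (g z) (h z))"
  using assms continuous_on_curried[of T f, OF _ assms(2-4)]
    continuous_on_curried[of T "partial_x f", OF _ assms(2-4)]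
    continuous_on_curried[of T "partial_t T f", OF _ assms(2-4)]
  unfolding C1_on_def by auto

lemma partial_x_matrix_mult:
  fixes f :: "real \<Rightarrow> real \<Rightarrow> real^'n^'m" and g :: "real \<Rightarrow> real \<Rightarrow> real^'p^'n"
  assumes "C1_on T f" and "C1_on T g" and "x \<in> {0..1}" and "t \<in> T"
  shows "partial_x (\<lambda>y \<tau>. f y \<tau> ** g y \<tau>) x t = f x t ** partial_x g x t + partial_x f x t ** g x t"
  and "((\<lambda>y. f y t ** g y t) has_vector_derivative partial_x (\<lambda>y \<tau>. f y \<tau> ** g y \<tau>) x t) (at x within {0..1})"
proof -
  note D = bounded_bilinear.has_vector_derivative[OF bounded_bilinear_matrix_matrix_mult
      C1_on_partial_x[OF assms(1,3,4)] C1_on_partial_x[OF assms(2,3,4)]]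
  show eq: "partial_x (\<lambda>y \<tau>. f y \<tau> ** g y \<tau>) x t = f x t ** partial_x g x t + partial_x f x t ** g x t"
    by (rule partial_x_eqI, rule D, rule assms(3))
  show "((\<lambda>y. f y t ** g y t) has_vector_derivative partial_x (\<lambda>y \<tau>. f y \<tau> ** g y \<tau>) x t) (at x within {0..1})"
    unfolding eq by (rule D)
qed

lemma partial_x_diff:
  assumes "C1_on T f" and "C1_on T g" and "x \<in> {0..1}" and "t \<in> T"
  shows "partial_x (\<lambda>x t. f x t - g x t) x t = partial_x f x t - partial_x g x t"
  by (intro partial_x_eqI has_vector_derivative_diff C1_on_partial_x[OF assms(1)]
      C1_on_partial_x[OF assms(2)] assms)

lemma partial_t_diff:
  assumes "C1_on UNIV f" and "C1_on UNIV g" and "x \<in> {0..1}"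
  shows "partial_t UNIV (\<lambda>x t. f x t - g x t) x t = partial_t UNIV f x t - partial_t UNIV g x t"
  by (intro partial_t_eqI has_vector_derivative_diff C1_on_partial_t[OF assms(1)]
      C1_on_partial_t[OF assms(2)] assms) auto

text \<open>All three suprema are nonnegative, so a pointwise value is bounded by its own supremum
  and hence by the sum. Derivatives of the difference are first rewritten as differences of bounded
  derivatives.\<close>

lemma BC1_norm_diff:
  fixes f g :: "real \<Rightarrow> real \<Rightarrow> 'b::euclidean_space"
  assumes f: "BC1 f" and g: "BC1 g" and x: "x \<in> {0..1}"
  shows infnorm_diff_le_BC1_norm: "infnorm (f x t - g x t) \<le> BC1_norm (\<lambda>x t. f x t - g x t)"
    and infnorm_partial_x_diff_le_BC1_norm:
      "infnorm (partial_x f x t - partial_x g x t) \<le> BC1_norm (\<lambda>x t. f x t - g x t)"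
proof -
  have C1: "C1_on UNIV f" "C1_on UNIV g"
    using f g by (auto simp: BC1_def)
  let ?F = "\<lambda>z. f (fst z) (snd z) - g (fst z) (snd z)"
    and ?X = "\<lambda>z. partial_x f (fst z) (snd z) - partial_x g (fst z) (snd z)"
    and ?T = "\<lambda>z. partial_t UNIV f (fst z) (snd z) - partial_t UNIV g (fst z) (snd z)"
  have F: "bdd_above ((\<lambda>z. infnorm (?F z)) ` strip)"
    and X: "bdd_above ((\<lambda>z. infnorm (?X z)) ` strip)"
    and T: "bdd_above ((\<lambda>z. infnorm (?T z)) ` strip)"
    using f g unfolding BC1_def split_beta
    by (auto intro!: bounded_imp_bdd_above_infnorm bounded_minus_comp)
  have eq: "BC1_norm (\<lambda>x t. f x t - g x t) =
      (SUP z\<in>strip. infnorm (?F z)) + (SUP z\<in>strip. infnorm (?X z)) + (SUP z\<in>strip. infnorm (?T z))"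
    unfolding BC1_norm_def split_beta
    by (intro arg_cong2[where f = "(+)"] SUP_cong refl)
      (auto simp: partial_x_diff[OF C1] partial_t_diff[OF C1])
  have z: "(x, t) \<in> strip" using x by simp
  have le: "infnorm (?F (x, t)) \<le> (SUP z\<in>strip. infnorm (?F z))"
    "infnorm (?X (x, t)) \<le> (SUP z\<in>strip. infnorm (?X z))"
    "infnorm (?T (x, t)) \<le> (SUP z\<in>strip. infnorm (?T z))"
    by (rule cSUP_upper[OF z F], rule cSUP_upper[OF z X], rule cSUP_upper[OF z T])
  show "infnorm (f x t - g x t) \<le> BC1_norm (\<lambda>x t. f x t - g x t)"
    "infnorm (partial_x f x t - partial_x g x t) \<le> BC1_norm (\<lambda>x t. f x t - g x t)"
    unfolding eq using le infnorm_pos_le[of "?F (x, t)"] infnorm_pos_le[of "?X (x, t)"]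
      infnorm_pos_le[of "?T (x, t)"] unfolding fst_conv snd_conv by linarith+
qed

section \<open>Energy decay\<close>

text \<open>The function \<open>exp (c * (\<tau> - s)) * E \<tau>\<close> has nonpositive derivative
  and is therefore nonincreasing.\<close>

lemma gronwall_decay:
  fixes E :: "real \<Rightarrow> real"
  assumes E: "\<And>\<tau>. s \<le> \<tau> \<Longrightarrow> (E has_real_derivative E' \<tau>) (at \<tau> within {s..})"
    and le: "\<And>\<tau>. s \<le> \<tau> \<Longrightarrow> E' \<tau> \<le> - c * E \<tau>" and "s \<le> t"
  shows "E t \<le> exp (- c * (t - s)) * E s"
proof -
  let ?F = "\<lambda>\<tau>. exp (c * (\<tau> - s)) * E \<tau>"
  have F: "(?F has_real_derivative exp (c * (\<tau> - s)) * (c * E \<tau> + E' \<tau>)) (at \<tau> within {s..})" if "s \<le> \<tau>" for \<tau>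
    by (rule derivative_eq_intros E[OF that] refl)+ (simp add: algebra_simps)
  have "?F t \<le> ?F s"
  proof (rule DERIV_nonpos_imp_decreasing_open[OF \<open>s \<le> t\<close>])
    fix \<tau> assume "s < \<tau>" "\<tau> < t"
    \<comment> \<open>After the initial time the derivative within \<open>{s..}\<close> is
      two-sided; at \<open>s\<close> itself continuity is enough.\<close>
    then have "at \<tau> within {s..} = at \<tau>"
      by (intro at_within_interior) (auto simp: interior_Ici)
    with F[of \<tau>] le[of \<tau>] \<open>s < \<tau>\<close> show "\<exists>y. (?F has_real_derivative y) (at \<tau>) \<and> y \<le> 0"
      by (intro exI[of _ "exp (c * (\<tau> - s)) * (c * E \<tau> + E' \<tau>)"]) (auto intro!: mult_nonneg_nonpos)
  next
    have "continuous_on {s..} ?F"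
      using F by (auto simp: continuous_on_eq_continuous_within intro: DERIV_continuous)
    then show "continuous_on {s..t} ?F"
      by (rule continuous_on_subset) auto
  qed
  then have "exp (- c * (t - s)) * ?F t \<le> exp (- c * (t - s)) * E s"
    by (intro mult_left_mono) auto
  moreover have "exp (- c * (t - s)) * ?F t = E t"
    by (simp add: mult.assoc[symmetric] flip: exp_add)
  ultimately show ?thesis by (simp only:)
qed

section \<open>Boundary traces in terms of outgoing components\<close>

text \<open>For \<open>pos j \<le> m\<close>, row \<open>j\<close> of \<open>J0\<close> holds
  boundary coefficients, and its product with the outgoing vector splits into the two sums of
  \<open>bdry_op\<close>. The other rows are identity rows, and there the vector already carries
  \<open>u 0\<close>.\<close>

lemma J0_trace:
  fixes u :: "real \<Rightarrow> 'n::{finite,linorder} rvec"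
  assumes bc: "\<And>j. pos j \<le> m \<Longrightarrow> u 0 $ j = bdry_op m r j u"
  shows "u 0 = J0 m r *v (\<chi> k. if pos k \<le> m then u 1 $ k else u 0 $ k)"
proof -
  let ?w = "\<chi> k. if pos k \<le> m then u 1 $ k else u 0 $ k"
  have "(J0 m r *v ?w) $ j = u 0 $ j" for j
  proof (cases "pos j \<le> m")
    case True
    then have "(J0 m r *v ?w) $ j = (\<Sum>k\<in>UNIV. r $ j $ k * (if pos k \<le> m then u 1 $ k else u 0 $ k))"
      by (simp add: J0_def matrix_vector_mult_def)
    also have "\<dots> = (\<Sum>k | pos k \<le> m. r $ j $ k * u 1 $ k) + (\<Sum>k | m < pos k. r $ j $ k * u 0 $ k)"
      by (simp add: if_distrib sum.If_cases not_le flip: Collect_neg_eq)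
    also have "\<dots> = u 0 $ j"
      unfolding bc[OF True] bdry_op_def by (rule add.commute)
    finally show ?thesis .
  next
    case False
    then have "(J0 m r *v ?w) $ j = (mat 1 *v ?w) $ j"
      by (simp add: J0_def matrix_vector_mult_def)
    with False show ?thesis
      by (simp add: not_le not_less)
  qed
  then show ?thesis
    by (simp add: vec_eq_iff)
qed

text \<open>Mirror image at x = 1: now the rows with \<open>pos j \<le> m\<close> are identity rows,
  where the outgoing vector carries \<open>u 1\<close>.\<close>

lemma J1_trace:
  fixes u :: "real \<Rightarrow> 'n::{finite,linorder} rvec"
  assumes bc: "\<And>j. m < pos j \<Longrightarrow> u 1 $ j = bdry_op m r j u"
  shows "u 1 = J1 m r *v (\<chi> k. if pos k \<le> m then u 1 $ k else u 0 $ k)"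
proof -
  let ?w = "\<chi> k. if pos k \<le> m then u 1 $ k else u 0 $ k"
  have "(J1 m r *v ?w) $ j = u 1 $ j" for j
  proof (cases "m < pos j")
    case True
    then have "(J1 m r *v ?w) $ j = (\<Sum>k\<in>UNIV. r $ j $ k * (if pos k \<le> m then u 1 $ k else u 0 $ k))"
      by (simp add: J1_def matrix_vector_mult_def)
    also have "\<dots> = (\<Sum>k | pos k \<le> m. r $ j $ k * u 1 $ k) + (\<Sum>k | m < pos k. r $ j $ k * u 0 $ k)"
      by (simp add: if_distrib sum.If_cases not_le flip: Collect_neg_eq)
    also have "\<dots> = u 1 $ j"
      unfolding bc[OF True] bdry_op_def by (rule add.commute)
    finally show ?thesis .
  next
    case False
    then have "(J1 m r *v ?w) $ j = (mat 1 *v ?w) $ j"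
      by (simp add: J1_def matrix_vector_mult_def)
    with False show ?thesis
      by (simp add: not_le not_less)
  qed
  then show ?thesis
    by (simp add: vec_eq_iff)
qed

section \<open>Energy estimate and passage to generalized solutions\<close>

text \<open>The coefficients are tied to \<open>V\<close> only by symmetry and the inequalities
  \<open>dissip\<close> and \<open>bdry\<close>, so that the estimate applies to perturbed
  \<open>a\<close> and \<open>b\<close> with the original \<open>V\<close>.\<close>

lemma energy_decay:
  fixes u :: "real \<Rightarrow> real \<Rightarrow> 'n::{finite,linorder} rvec"
  assumes V: "C1_on UNIV V" and a: "C1_on UNIV a" and u: "classical_solution m r a b s \<phi> u"
    and symV: "\<And>x t. x \<in> {0..1} \<Longrightarrow> transpose (V x t) = V x t"
    and symVa: "\<And>x t. x \<in> {0..1} \<Longrightarrow> transpose (V x t ** a x t) = V x t ** a x t"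
    and dissip: "\<And>x t v. x \<in> {0..1} \<Longrightarrow>
      qform (partial_t UNIV V x t + partial_x (\<lambda>y \<tau>. V y \<tau> ** a y \<tau>) x t
        - V x t ** b x t - transpose (b x t) ** V x t) v \<le> - c * qform (V x t) v"
    and bdry: "\<And>t v. qform (V 0 t ** a 0 t) (J0 m r *v v) \<le> qform (V 1 t ** a 1 t) (J1 m r *v v)"
    and "s \<le> t"
  shows "integral {0..1} (\<lambda>x. qform (V x t) (u x t))
    \<le> exp (- c * (t - s)) * integral {0..1} (\<lambda>x. qform (V x s) (u x s))"
proof (rule gronwall_decay[OF _ _ \<open>s \<le> t\<close>])
  have C1: "C1_on {s..} u" using u by (simp add: classical_solution_def)
  \<comment> \<open>Time derivative of the energy density, before the equation eliminates the time
    derivative of \<open>u\<close>.\<close>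
  let ?e = "\<lambda>\<tau> x. qform (partial_t UNIV V x \<tau>) (u x \<tau>) + 2 * ((V x \<tau> *v u x \<tau>) \<bullet> partial_t {s..} u x \<tau>)"
  have cV: "continuous_on S (\<lambda>z. V (g z) (h z))" "continuous_on S (\<lambda>z. partial_t UNIV V (g z) (h z))"
    if "continuous_on S g" "continuous_on S h" "\<And>z. z \<in> S \<Longrightarrow> g z \<in> {0..1} \<and> h z \<in> {s..}" 
    for S :: "'z::t2_space set" and g h
    using C1_on_continuous[OF V that(1,2)] that(3) by auto
  have ce: "continuous_on S (\<lambda>z. ?e (h z) (g z))" 
    if "continuous_on S g" "continuous_on S h" "\<And>z. z \<in> S \<Longrightarrow> g z \<in> {0..1} \<and> h z \<in> {s..}" 
    for S :: "'z::t2_space set" and g h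
    by (intro continuous_intros bounded_bilinear.continuous_on[OF bounded_bilinear_matrix_vector_mult]
        cV C1_on_continuous[OF C1] that)
  have cq: "continuous_on {0..1} (\<lambda>x. qform (V x \<tau>) (u x \<tau>))" if "s \<le> \<tau>" for \<tau>
    using that by (intro continuous_intros cV C1_on_continuous[OF C1]) auto
  show "((\<lambda>\<tau>. integral {0..1} (\<lambda>x. qform (V x \<tau>) (u x \<tau>))) has_real_derivative integral {0..1} (?e \<tau>))
      (at \<tau> within {s..})" if "s \<le> \<tau>" for \<tau>
    unfolding has_real_derivative_iff_has_vector_derivative interval_cbox
  proof (rule leibniz_rule_vector_derivative)
    show "((\<lambda>\<tau>. qform (V x \<tau>) (u x \<tau>)) has_vector_derivative ?e \<tau> x) (at \<tau> within {s..})"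
      if "\<tau> \<in> {s..}" "x \<in> cbox 0 1" for \<tau> x
      using that unfolding has_real_derivative_iff_has_vector_derivative[symmetric]
      by (intro qform_has_vector_derivative C1_on_partial_t[OF C1]
          has_vector_derivative_at_within[OF C1_on_partial_t[OF V]] symV) auto
    show "(\<lambda>x. qform (V x \<tau>) (u x \<tau>)) integrable_on cbox 0 1" if "\<tau> \<in> {s..}" for \<tau>
      using cq[of \<tau>] that by (intro integrable_continuous) auto
    show "continuous_on ({s..} \<times> cbox 0 1) (\<lambda>(\<tau>, x). ?e \<tau> x)"
      unfolding split_beta by (rule ce) (auto intro!: continuous_intros)
  qed (use that in auto)
  show "integral {0..1} (?e \<tau>) \<le> - c * integral {0..1} (\<lambda>x. qform (V x \<tau>) (u x \<tau>))" if \<tau>: "s \<le> \<tau>" for \<tau>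
  proof -
    let ?A = "\<lambda>x. V x \<tau> ** a x \<tau>" and ?A' = "\<lambda>x. partial_x (\<lambda>y \<tau>. V y \<tau> ** a y \<tau>) x \<tau>"
    \<comment> \<open>\<open>G\<close> is the flux density. The integral of its x-derivative is the
      boundary term \<open>G 1 - G 0\<close>, nonnegative by \<open>bdry\<close>.\<close>
    define G where "G x = qform (?A x) (u x \<tau>)" for x
    define G' where "G' x = qform (?A' x) (u x \<tau>) + 2 * ((?A x *v u x \<tau>) \<bullet> partial_x u x \<tau>)" for x
    have "(G has_vector_derivative G' x) (at x within {0..1})" if "x \<in> {0..1}" for x
      unfolding G_def G'_def has_real_derivative_iff_has_vector_derivative[symmetric]
      using that \<tau> by (intro qform_has_vector_derivative partial_x_matrix_mult(2)[OF V a]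
          C1_on_partial_x[OF C1] symVa) auto
    then have G: "(G' has_integral G 1 - G 0) {0..1}"
      by (intro fundamental_theorem_of_calculus) auto
    let ?w = "\<chi> k. if pos k \<le> m then u 1 \<tau> $ k else u 0 \<tau> $ k"
    have "u 0 \<tau> = J0 m r *v ?w" "u 1 \<tau> = J1 m r *v ?w"
      using u \<tau> by (intro J0_trace[of m "\<lambda>x. u x \<tau>"] J1_trace[of m "\<lambda>x. u x \<tau>"];
          simp add: classical_solution_def)+
    then have G01: "G 0 \<le> G 1"
      using bdry[of \<tau> ?w] by (simp add: G_def)
    \<comment> \<open>The equation is available only for interior \<open>x\<close>, so the integrals
      pass to the open interval before integrands are compared.\<close>
    have e: "(?e \<tau> has_integral integral {0..1} (?e \<tau>)) {0<..<1}"
      unfolding has_integral_Icc_iff_Ioo[symmetric]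
      by (intro integrable_integral integrable_continuous_interval ce) (use \<tau> in \<open>auto intro!: continuous_intros\<close>)
    have q: "((\<lambda>x. - c * qform (V x \<tau>) (u x \<tau>)) has_integral
        - c * integral {0..1} (\<lambda>x. qform (V x \<tau>) (u x \<tau>))) {0..1}"
      by (intro has_integral_mult_right integrable_integral integrable_continuous_interval cq \<tau>)
    have "integral {0..1} (?e \<tau>) \<le> - c * integral {0..1} (\<lambda>x. qform (V x \<tau>) (u x \<tau>)) - (G 1 - G 0)"
    proof (rule has_integral_le[OF e has_integral_diff[OF q G, unfolded has_integral_Icc_iff_Ioo]])
      fix x :: real assume x: "x \<in> {0<..<1}"
      let ?u = "u x \<tau>" and ?V = "V x \<tau>" and ?a = "a x \<tau>" and ?b = "b x \<tau>" and ?ux = "partial_x u x \<tau>"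
      have "partial_t {s..} u x \<tau> + ?a *v ?ux + ?b *v ?u = 0"
        using u x \<tau> by (auto simp: classical_solution_def)
      then have ut: "partial_t {s..} u x \<tau> = - (?a *v ?ux) - ?b *v ?u"
        by (simp add: eq_diff_eq eq_neg_iff_add_eq_0 add_ac)
      \<comment> \<open>Symmetry of \<open>V\<close> and of \<open>V ** a\<close> moves both
        matrices onto \<open>u\<close>, which produces the term occurring in
        \<open>G'\<close>.\<close>
      have 1: "(?V *v ?u) \<bullet> (?a *v ?ux) = ((?V ** ?a) *v ?u) \<bullet> ?ux"
        using symV[of x \<tau>] symVa[of x \<tau>] x
        by (simp add: symmetric_matrix_inner matrix_vector_mul_assoc)
      have 2: "(?V *v ?u) \<bullet> (?b *v ?u) = qform (?V ** ?b) ?u"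
        using symV[of x \<tau>] x
        by (simp add: symmetric_matrix_inner matrix_vector_mul_assoc qform_def inner_commute[of ?u])
      have 3: "qform (transpose ?b ** ?V) ?u = qform (?V ** ?b) ?u"
        using symV[of x \<tau>] x qform_transpose[of "?V ** ?b" ?u]
        by (simp add: matrix_transpose_mul)
      \<comment> \<open>Adding and subtracting the form of \<open>?A' x\<close> completes the
        transport term to \<open>- G' x\<close> and leaves exactly the form controlled by
        \<open>dissip\<close>.\<close>
      have "?e \<tau> x = qform (partial_t UNIV V x \<tau> + ?A' x - ?V ** ?b - transpose ?b ** ?V) ?u - G' x"
        unfolding ut G'_def qform_add qform_diff 3
        by (simp add: inner_diff_right 1 2)
      also have "\<dots> \<le> - c * qform ?V ?u - G' x"
        using dissip[of x \<tau> ?u] x by simp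
      finally show "?e \<tau> x \<le> - c * qform ?V ?u - G' x" .
    qed
    with G01 show ?thesis by linarith
  qed
qed

text \<open>The classical estimate passes to the limit along dense data; the existence clause in
  \<open>L2_generalized_solution\<close> supplies the classical solutions. The factor 4 comes from
  two uses of \<open>L2_norm_power2_le\<close>, at times \<open>t\<close> and
  \<open>s\<close>.\<close>

lemma generalized_solution_decay:
  fixes u :: "real \<Rightarrow> real \<Rightarrow> 'n::{finite,linorder} rvec"
  assumes gen: "L2_generalized_solution m r a b s \<phi> u" and \<phi>: "L2_fun \<phi>"
    and decay: "\<And>\<psi> w. classical_solution m r a b s \<psi> w \<Longrightarrow>
      (L2_norm (\<lambda>x. w x t))\<^sup>2 \<le> C * (L2_norm \<psi>)\<^sup>2"
    and "0 \<le> C" and "s \<le> t"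
  shows "(L2_norm (\<lambda>x. u x t))\<^sup>2 \<le> 4 * C * (L2_norm \<phi>)\<^sup>2"
proof -
  obtain \<phi>l where \<phi>l: "\<And>l::nat. C01 (\<phi>l l)" "(\<lambda>l. L2_norm (\<lambda>x. \<phi>l l x - \<phi> x)) \<longlonglongrightarrow> 0"
    by (rule C01_dense_L2[OF \<phi>]) blast
  with gen have ex: "\<forall>l. \<exists>w. classical_solution m r a b s (\<phi>l l) w"
    and conv: "\<And>ul s1. \<forall>l. classical_solution m r a b s (\<phi>l l) (ul l) \<Longrightarrow> s1 > 0 \<Longrightarrow>
      uniform_limit {s..s + s1} (\<lambda>l \<theta>. L2_norm (\<lambda>x. u x \<theta> - ul l x \<theta>)) (\<lambda>_. 0) sequentially"
    unfolding L2_generalized_solution_def by blast+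
  from ex obtain ul where ul: "\<And>l. classical_solution m r a b s (\<phi>l l) (ul l)"
    by metis
  \<comment> \<open>The extra 1 keeps the interval length positive when
    \<open>t = s\<close>.\<close>
  have "uniform_limit {s..s + (t - s + 1)} (\<lambda>l \<theta>. L2_norm (\<lambda>x. u x \<theta> - ul l x \<theta>)) (\<lambda>_. 0) sequentially"
    using ul \<open>s \<le> t\<close> by (intro conv) auto
  then have lim: "(\<lambda>l. L2_norm (\<lambda>x. u x t - ul l x t)) \<longlonglongrightarrow> 0"
    by (rule tendsto_uniform_limitI) (use \<open>s \<le> t\<close> in auto)
  have u2: "L2_fun (\<lambda>x. u x t)"
    using gen \<open>s \<le> t\<close> by (simp add: L2_generalized_solution_def continuous_L2_from_def)
  have ul2: "L2_fun (\<lambda>x. ul l x \<tau>)" if "s \<le> \<tau>" for l \<tau>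
  proof (rule continuous_imp_L2_fun)
    have "C1_on {s..} (ul l)"
      using ul[of l] by (simp add: classical_solution_def)
    from C1_on_continuous(1)[OF this continuous_on_id continuous_on_const, of "{0..1}" \<tau>] that
    show "continuous_on {0..1} (\<lambda>x. ul l x \<tau>)"
      by simp
  qed
  have le: "(L2_norm (\<lambda>x. u x t))\<^sup>2 \<le> 2 * (L2_norm (\<lambda>x. u x t - ul l x t))\<^sup>2
      + 2 * (C * (2 * (L2_norm (\<lambda>x. \<phi>l l x - \<phi> x))\<^sup>2 + 2 * (L2_norm \<phi>)\<^sup>2))" for l
  proof -
    have init: "ul l x s = \<phi>l l x" if "x \<in> {0<..<1}" for x
      using ul[of l] that by (simp add: classical_solution_def)
    have "(L2_norm (\<lambda>x. ul l x s))\<^sup>2 \<le> 2 * (L2_norm (\<lambda>x. ul l x s - \<phi> x))\<^sup>2 + 2 * (L2_norm \<phi>)\<^sup>2"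
      by (rule L2_norm_power2_le[OF ul2[OF order_refl] \<phi>])
    moreover have "L2_norm (\<lambda>x. ul l x s) = L2_norm (\<phi>l l)"
      "L2_norm (\<lambda>x. ul l x s - \<phi> x) = L2_norm (\<lambda>x. \<phi>l l x - \<phi> x)"
      using init by (auto intro: L2_norm_cong)
    ultimately have "(L2_norm (\<phi>l l))\<^sup>2 \<le> 2 * (L2_norm (\<lambda>x. \<phi>l l x - \<phi> x))\<^sup>2 + 2 * (L2_norm \<phi>)\<^sup>2"
      by simp
    from mult_left_mono[OF this \<open>0 \<le> C\<close>] show ?thesis
      using decay[OF ul[of l]] L2_norm_power2_le[OF u2 ul2[OF \<open>s \<le> t\<close>, of l]] by linarith
  qed
  have "(\<lambda>l. 2 * (L2_norm (\<lambda>x. u x t - ul l x t))\<^sup>2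
      + 2 * (C * (2 * (L2_norm (\<lambda>x. \<phi>l l x - \<phi> x))\<^sup>2 + 2 * (L2_norm \<phi>)\<^sup>2)))
      \<longlonglongrightarrow> 2 * 0\<^sup>2 + 2 * (C * (2 * 0\<^sup>2 + 2 * (L2_norm \<phi>)\<^sup>2))"
    by (intro tendsto_intros lim \<phi>l(2))
  from LIMSEQ_le_const[OF this] le show ?thesis
    by (auto simp: algebra_simps)
qed

section \<open>Robustness\<close>

text \<open>The time derivative of \<open>V\<close> cancels in the difference. What remains comes
  from \<open>V\<close> times the change of \<open>partial_x a\<close>, from
  \<open>partial_x V\<close> times the change of \<open>a\<close>, and twice from \<open>V\<close>
  times the change of \<open>b\<close>: K0 + K1 + 2 K0 = 3 K0 + K1.\<close>

lemma robust_lyapunov_estimates: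
  fixes V a a' b b' :: "real \<Rightarrow> real \<Rightarrow> real^'n^'n"
  assumes V: "C1_on UNIV V" and a: "C1_on UNIV a" and a': "C1_on UNIV a'"
    and x: "x \<in> {0..1}" and sym: "transpose (V x t) = V x t"
    and K0: "norm (V x t) \<le> K0" and K1: "norm (partial_x V x t) \<le> K1"
    and da: "norm (a' x t - a x t) \<le> \<delta>" and dax: "norm (partial_x a' x t - partial_x a x t) \<le> \<delta>"
    and db: "norm (b' x t - b x t) \<le> \<delta>"
  shows "qform (partial_t UNIV V x t + partial_x (\<lambda>y \<tau>. V y \<tau> ** a' y \<tau>) x t
        - V x t ** b' x t - transpose (b' x t) ** V x t) v
    \<le> qform (partial_t UNIV V x t + partial_x (\<lambda>y \<tau>. V y \<tau> ** a y \<tau>) x t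
        - V x t ** b x t - transpose (b x t) ** V x t) v + (3 * K0 + K1) * \<delta> * (norm v)\<^sup>2"
proof -
  let ?D = "a' x t - a x t" and ?Dx = "partial_x a' x t - partial_x a x t" and ?B = "b' x t - b x t"
  have diff: "A ** (B - C) = A ** B - A ** C" for A B C :: "real^'n^'n"
    by (rule bounded_bilinear.diff_right[OF bounded_bilinear_matrix_matrix_mult])
  have transpose_qform: "qform (transpose B ** V x t) v = qform (V x t ** B) v" for B
    using sym qform_transpose[of "V x t ** B" v] by (simp add: matrix_transpose_mul)
  have bound: "\<bar>qform (A ** B) v\<bar> \<le> K * \<delta> * (norm v)\<^sup>2"
    if "norm A \<le> K" "norm B \<le> \<delta>" for A B :: "real^'n^'n" and K
    using that order_trans[OF norm_ge_zero that(1)]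
    by (intro order_trans[OF abs_qform_mult_le] mult_right_mono mult_mono) auto
  have "qform (partial_t UNIV V x t + partial_x (\<lambda>y \<tau>. V y \<tau> ** a' y \<tau>) x t
        - V x t ** b' x t - transpose (b' x t) ** V x t) v
    = qform (partial_t UNIV V x t + partial_x (\<lambda>y \<tau>. V y \<tau> ** a y \<tau>) x t
        - V x t ** b x t - transpose (b x t) ** V x t) v
      + qform (V x t ** ?Dx) v + qform (partial_x V x t ** ?D) v - 2 * qform (V x t ** ?B) v"
    unfolding partial_x_matrix_mult(1)[OF V a x UNIV_I] partial_x_matrix_mult(1)[OF V a' x UNIV_I]
      diff qform_add qform_diff transpose_qform by simp
  moreover have "(3 * K0 + K1) * \<delta> * (norm v)\<^sup>2
      = K0 * \<delta> * (norm v)\<^sup>2 + K1 * \<delta> * (norm v)\<^sup>2 + 2 * (K0 * \<delta> * (norm v)\<^sup>2)"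
    by (simp add: algebra_simps)
  ultimately show ?thesis
    using bound[OF K0 dax] bound[OF K1 da] bound[OF K0 db] by linarith
qed

text \<open>The boundary matrices stay fixed while the speeds change from \<open>A0\<close>,
  \<open>A1\<close> to \<open>B0\<close>, \<open>B1\<close>, so the error at each end is a form of
  \<open>V0 ** (B0 - A0)\<close> or \<open>V1 ** (B1 - A1)\<close> at the corresponding
  trace.\<close>

lemma robust_boundary_estimate:
  fixes A0 A1 B0 B1 V0 V1 :: "real^'n^'n" and J J' :: "real^'n^'n"
  assumes V: "norm V0 \<le> K" "norm V1 \<le> K" and d: "norm (B0 - A0) \<le> \<delta>" "norm (B1 - A1) \<le> \<delta>"
  shows "qform (V0 ** B0) (J *v v) - qform (V1 ** B1) (J' *v v)
    \<le> qform (transpose J ** V0 ** A0 ** J - transpose J' ** V1 ** A1 ** J') v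
      + K * \<delta> * ((norm J)\<^sup>2 + (norm J')\<^sup>2) * (norm v)\<^sup>2"
proof -
  have bound: "\<bar>qform (A ** D) (L *v v)\<bar> \<le> K * \<delta> * ((norm L)\<^sup>2 * (norm v)\<^sup>2)"
    if "norm A \<le> K" "norm D \<le> \<delta>" for A D L :: "real^'n^'n"
  proof -
    have "(norm (L *v v))\<^sup>2 \<le> (norm L)\<^sup>2 * (norm v)\<^sup>2"
      unfolding power_mult_distrib[symmetric] by (intro power_mono norm_matrix_vector_mult_le) simp
    then show ?thesis
      using that order_trans[OF norm_ge_zero that(1)] order_trans[OF norm_ge_zero that(2)]
      by (intro order_trans[OF abs_qform_mult_le] mult_mono) auto
  qed
  have "qform (V0 ** B0) (J *v v) - qform (V1 ** B1) (J' *v v)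
    = qform (transpose J ** V0 ** A0 ** J - transpose J' ** V1 ** A1 ** J') v
      + qform (V0 ** (B0 - A0)) (J *v v) - qform (V1 ** (B1 - A1)) (J' *v v)"
    unfolding bounded_bilinear.diff_right[OF bounded_bilinear_matrix_matrix_mult] qform_diff
      matrix_mul_assoc[of "transpose _" V0 A0, symmetric] matrix_mul_assoc[of "transpose _" V1 A1, symmetric]
      qform_congruence by simp
  moreover have "K * \<delta> * ((norm J)\<^sup>2 + (norm J')\<^sup>2) * (norm v)\<^sup>2
    = K * \<delta> * ((norm J)\<^sup>2 * (norm v)\<^sup>2) + K * \<delta> * ((norm J')\<^sup>2 * (norm v)\<^sup>2)"
    by (simp add: algebra_simps)
  ultimately show ?thesis
    using bound[OF V(1) d(1), of J] bound[OF V(2) d(2), of J'] by linarith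
qed

text \<open>If diagonal entries move by at most a0/4, their differences move by at most a0/2, so the
  constant a0/2 survives.\<close>

lemma hyperbolic_perturb:
  fixes a :: "real \<Rightarrow> real \<Rightarrow> 'n::{finite,linorder} sqmat"
  assumes "hyperbolic m a"
  obtains \<gamma> where "0 < \<gamma>"
    and "\<And>a'. (\<And>x t j. x \<in> {0..1} \<Longrightarrow> \<bar>a' x t $ j $ j - a x t $ j $ j\<bar> \<le> \<gamma>) \<Longrightarrow> hyperbolic m a'"
proof -
  obtain a0 where a0: "0 < a0"
    and lo: "\<And>x t j. x \<in> {0..1} \<Longrightarrow> pos j \<le> m \<Longrightarrow> a x t $ j $ j \<ge> a0"
    and up: "\<And>x t j. x \<in> {0..1} \<Longrightarrow> m < pos j \<Longrightarrow> a x t $ j $ j \<le> - a0"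
    and sep: "\<And>x t j k. x \<in> {0..1} \<Longrightarrow> j \<noteq> k \<Longrightarrow> \<bar>a x t $ j $ j - a x t $ k $ k\<bar> \<ge> a0"
    using assms unfolding hyperbolic_def by fastforce
  show thesis
  proof (rule that[of "a0 / 4"])
    fix a' :: "real \<Rightarrow> real \<Rightarrow> 'n sqmat"
    assume d: "\<And>x t j. x \<in> {0..1} \<Longrightarrow> \<bar>a' x t $ j $ j - a x t $ j $ j\<bar> \<le> a0 / 4"
    have "a' x t $ j $ j \<ge> a0 / 2" if "x \<in> {0..1}" "pos j \<le> m" for x t j
      using lo[OF that, of t] d[OF that(1), of t j] a0 by linarith
    moreover have "a' x t $ j $ j \<le> - (a0 / 2)" if "x \<in> {0..1}" "m < pos j" for x t j
      using up[OF that, of t] d[OF that(1), of t j] a0 by linarith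
    moreover have "\<bar>a' x t $ j $ j - a' x t $ k $ k\<bar> \<ge> a0 / 2" if "x \<in> {0..1}" "j \<noteq> k" for x t j k
      using sep[OF that, of t] d[OF that(1), of t j] d[OF that(1), of t k] by linarith
    ultimately show "hyperbolic m a'"
      unfolding hyperbolic_def using a0 by (intro exI[of _ "a0 / 2"]) auto
  qed (use a0 in simp)
qed

theorem theorem2p2:
  fixes m :: nat
    and r :: "'n::{finite,linorder} sqmat"
    and a b V :: "real \<Rightarrow> real \<Rightarrow> 'n sqmat"
    and \<beta>1 \<beta>2 \<beta>3 \<beta>4 :: real
  assumes "2 \<le> CARD('n)" and "m \<le> CARD('n)"
    and "BC1 a" and "BC1 b" and "diagonal_on_strip a" and "hyperbolic m a"
    and "0 < \<beta>1" and "0 < \<beta>2" and "0 < \<beta>3" and "0 < \<beta>4"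
    and "diagonal_on_strip V" and "C1_on UNIV V"
    and V_x_bounded: "bounded ((\<lambda>(x, t). partial_x V x t) ` strip)"
    and i: "\<forall>(x, t)\<in>strip. \<forall>v.
      \<beta>1 * (infnorm v)\<^sup>2 \<le> (V x t *v v) \<bullet> v \<and> (V x t *v v) \<bullet> v \<le> \<beta>2 * (infnorm v)\<^sup>2"
    and ii: "\<forall>(x, t)\<in>strip. \<forall>v. v \<noteq> 0 \<longrightarrow>
      ((partial_t UNIV V x t + partial_x (\<lambda>y \<tau>. V y \<tau> ** a y \<tau>) x t
        - V x t ** b x t - transpose (b x t) ** V x t) *v v) \<bullet> v < - \<beta>3 * (infnorm v)\<^sup>2"
    and iii: "\<forall>t v. v \<noteq> 0 \<longrightarrow>
      ((transpose (J0 m r) ** V 0 t ** a 0 t ** J0 m r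
        - transpose (J1 m r) ** V 1 t ** a 1 t ** J1 m r) *v v) \<bullet> v < - \<beta>4 * (infnorm v)\<^sup>2"
  shows "robust_exponentially_stable m r a b"
proof -
  note \<beta> = assms(7-10) and V = \<open>C1_on UNIV V\<close>
  \<comment> \<open>\<open>N\<close> and \<open>\<kappa>\<close> convert max norms to Euclidean
    ones: \<open>N\<close> for squared vector norms, \<open>\<kappa>\<close> for matrix
    norms.\<close>
  define N where "N = real CARD('n)"
  define \<kappa> where "\<kappa> = sqrt (real DIM('n sqmat))"
  have N: "0 < N" and \<kappa>: "0 < \<kappa>"
    by (simp_all add: N_def \<kappa>_def)
  have norm_matrix: "norm A \<le> \<kappa> * infnorm A" for A :: "'n sqmat"
    unfolding \<kappa>_def by (rule norm_le_infnorm)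
  have norm2: "(norm v)\<^sup>2 \<le> N * (infnorm v)\<^sup>2" for v :: "'n rvec"
    unfolding N_def by (rule norm_power2_le_infnorm)
  have a: "C1_on UNIV a" using \<open>BC1 a\<close> by (simp add: BC1_def)
  have Vlo: "\<beta>1 * (infnorm v)\<^sup>2 \<le> qform (V x t) v" and Vup: "qform (V x t) v \<le> \<beta>2 * (infnorm v)\<^sup>2"
    if "x \<in> {0..1}" for x t v
    using i that by (auto simp: qform_def)
  have Vdiag: "V x t $ j $ k = 0" if "x \<in> {0..1}" "j \<noteq> k" for x t j k
    using \<open>diagonal_on_strip V\<close> that by (auto simp: diagonal_on_strip_def)
  \<comment> \<open>At \<open>v = 0\<close> both sides vanish, so the strict inequality for nonzero
    vectors gives a weak one for all. The same applies to \<open>bdry\<close>.\<close>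
  have diss: "qform (partial_t UNIV V x t + partial_x (\<lambda>y \<tau>. V y \<tau> ** a y \<tau>) x t
      - V x t ** b x t - transpose (b x t) ** V x t) v \<le> - \<beta>3 * (infnorm v)\<^sup>2" if "x \<in> {0..1}" for x t v
    using ii that by (cases "v = 0") (fastforce simp: qform_def infnorm_0 less_imp_le)+
  have bdry: "qform (transpose (J0 m r) ** V 0 t ** a 0 t ** J0 m r
      - transpose (J1 m r) ** V 1 t ** a 1 t ** J1 m r) v \<le> - \<beta>4 * (infnorm v)\<^sup>2" for t v
    using iii by (cases "v = 0") (auto simp: qform_def infnorm_0 less_imp_le)
  \<comment> \<open>Testing condition (i) with unit vectors places the diagonal entries of
    \<open>V\<close> between 0 and \<open>\<beta>2\<close>; the other entries are zero.\<close>
  define K0 where "K0 = \<kappa> * \<beta>2"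
  have K0: "norm (V x t) \<le> K0" if x: "x \<in> {0..1}" for x t
  proof -
    have "\<bar>V x t $ j $ k\<bar> \<le> \<beta>2" for j k
    proof (cases "j = k")
      case True
      have "(infnorm (axis j 1 :: 'n rvec))\<^sup>2 \<le> 1"
        using infnorm_power2_le[of "axis j 1 :: 'n rvec"] by simp
      with \<beta> have "\<beta>2 * (infnorm (axis j 1 :: 'n rvec))\<^sup>2 \<le> \<beta>2"
        by (simp add: mult_left_le)
      moreover have "0 \<le> \<beta>1 * (infnorm (axis j 1 :: 'n rvec))\<^sup>2"
        using \<beta> by simp
      moreover have "qform (V x t) (axis j 1) = V x t $ j $ j"
        by (simp add: qform_def matrix_vector_mul_component inner_axis)
      ultimately show ?thesis
        using Vlo[OF x, of "axis j 1" t] Vup[OF x, of t "axis j 1"] unfolding True[symmetric]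
        by linarith
    qed (use Vdiag[OF x] \<beta> in simp)
    then have "infnorm (V x t) \<le> \<beta>2"
      by (rule infnorm_matrix_le)
    then show ?thesis
      unfolding K0_def using norm_matrix[of "V x t"] mult_left_mono[of "infnorm (V x t)" \<beta>2 \<kappa>] \<kappa> by linarith
  qed
  \<comment> \<open>Condition (i) controls \<open>V\<close> only; the uniform bound on its
    x-derivative is taken from \<open>V_x_bounded\<close>.\<close>
  obtain K1 where "0 < K1" and K1: "\<And>x t. x \<in> {0..1} \<Longrightarrow> norm (partial_x V x t) \<le> K1"
    using V_x_bounded unfolding bounded_pos by fastforce
  obtain \<gamma>0 where "0 < \<gamma>0" and hyp:
    "\<And>a'. (\<And>x t j. x \<in> {0..1} \<Longrightarrow> \<bar>a' x t $ j $ j - a x t $ j $ j\<bar> \<le> \<gamma>0) \<Longrightarrow> hyperbolic m a'"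
    using hyperbolic_perturb[OF \<open>hyperbolic m a\<close>] by blast
  have "0 < K0" using \<kappa> \<beta> by (simp add: K0_def)
  \<comment> \<open>\<open>C1 * \<gamma>\<close> and \<open>C2 * \<gamma>\<close> are the factors of
    \<open>(infnorm v)\<^sup>2\<close> in the perturbation errors of the dissipation and boundary
    forms.\<close>
  define C1 where "C1 = (3 * K0 + K1) * \<kappa> * N"
  define C2 where "C2 = K0 * \<kappa> * ((norm (J0 m r))\<^sup>2 + (norm (J1 m r))\<^sup>2) * N"
  have C1: "0 < C1" using \<open>0 < K0\<close> \<open>0 < K1\<close> \<kappa> N by (simp add: C1_def add_pos_pos)
  have C2: "0 \<le> C2" using \<open>0 < K0\<close> \<kappa> N by (simp add: C2_def)
  \<comment> \<open>The three bounds keep hyperbolicity, spend half of \<open>\<beta>3\<close> so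
    that the other half drives the decay, and spend at most \<open>\<beta>4\<close>, since the
    boundary form need only be nonpositive. The 1 added to \<open>C2\<close> keeps the denominator
    positive, as only \<open>0 \<le> C2\<close> is shown.\<close>
  define \<gamma> where "\<gamma> = min \<gamma>0 (min (\<beta>3 / 2 / C1) (\<beta>4 / (C2 + 1)))"
  have "0 < \<gamma>" using \<open>0 < \<gamma>0\<close> \<beta> C1 C2 by (simp add: \<gamma>_def)
  have \<gamma>1: "C1 * \<gamma> \<le> \<beta>3 / 2"
  proof -
    have "\<gamma> \<le> \<beta>3 / 2 / C1" by (simp add: \<gamma>_def)
    then show ?thesis using C1 by (simp add: pos_le_divide_eq mult_ac)
  qed
  have \<gamma>2: "C2 * \<gamma> \<le> \<beta>4"
  proof -
    have "\<gamma> \<le> \<beta>4 / (C2 + 1)" by (simp add: \<gamma>_def)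
    then have "(C2 + 1) * \<gamma> \<le> \<beta>4" using C2 by (simp add: pos_le_divide_eq mult.commute)
    then show ?thesis using \<open>0 < \<gamma>\<close> by (simp add: distrib_right)
  qed
  \<comment> \<open>By the upper bound in (i), the remaining dissipation
    \<open>\<beta>3 / 2 * (infnorm v)\<^sup>2\<close> is at least \<open>c\<close> times the energy
    density.\<close>
  define c where "c = \<beta>3 / (2 * \<beta>2)"
  have "0 < c" using \<beta> by (simp add: c_def)
  \<comment> \<open>The squared L2 norm will be bounded with constant
    \<open>4 * (\<beta>2 * N / \<beta>1)\<close> and rate \<open>c\<close>. Taking roots gives this
    \<open>M\<close> and the rate \<open>c / 2\<close>; the maximum secures
    \<open>1 \<le> M\<close>.\<close>
  define M where "M = max 1 (2 * sqrt (\<beta>2 * N / \<beta>1))"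
  show ?thesis
    unfolding robust_exponentially_stable_def
  proof (intro exI conjI allI impI)
    show "0 < \<gamma>" by fact
    show "1 \<le> M" by (simp add: M_def)
    show "0 < c / 2" using \<open>0 < c\<close> by simp
  next
    fix a' assume "BC1 a' \<and> diagonal_on_strip a' \<and> BC1_norm (\<lambda>x t. a' x t - a x t) \<le> \<gamma>"
    then have "infnorm (a' x t - a x t) \<le> \<gamma>" if "x \<in> {0..1}" for x t
      using infnorm_diff_le_BC1_norm[OF _ \<open>BC1 a\<close> that, of a' t] by auto
    then have "\<bar>a' x t $ j $ j - a x t $ j $ j\<bar> \<le> \<gamma>0" if "x \<in> {0..1}" for x t j
      using matrix_component_le_infnorm[of "a' x t - a x t" j j] that order_trans
      by (fastforce simp: \<gamma>_def)
    then show "hyperbolic m a'" by (rule hyp)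
  next
    fix s \<phi> a' b' u t
    assume "L2_fun \<phi> \<and> BC1 a' \<and> diagonal_on_strip a' \<and> BC1_norm (\<lambda>x t. a' x t - a x t) \<le> \<gamma> \<and>
      BC1 b' \<and> BC1_norm (\<lambda>x t. b' x t - b x t) \<le> \<gamma> \<and> L2_generalized_solution m r a' b' s \<phi> u"
      and "s \<le> t"
    then have \<phi>: "L2_fun \<phi>" and a': "BC1 a'" and a'_diag: "diagonal_on_strip a'"
      and a'\<gamma>: "BC1_norm (\<lambda>x t. a' x t - a x t) \<le> \<gamma>"
      and b': "BC1 b'" and b'\<gamma>: "BC1_norm (\<lambda>x t. b' x t - b x t) \<le> \<gamma>"
      and gen: "L2_generalized_solution m r a' b' s \<phi> u" by auto
    have a'C1: "C1_on UNIV a'" using a' by (simp add: BC1_def)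
    have norm_le: "norm A \<le> \<kappa> * \<gamma>" if "infnorm A \<le> \<gamma>" for A :: "'n sqmat"
      using norm_matrix[of A] mult_left_mono[OF that, of \<kappa>] \<kappa> by linarith
    have da: "norm (a' x \<tau> - a x \<tau>) \<le> \<kappa> * \<gamma>"
      and dax: "norm (partial_x a' x \<tau> - partial_x a x \<tau>) \<le> \<kappa> * \<gamma>"
      and db: "norm (b' x \<tau> - b x \<tau>) \<le> \<kappa> * \<gamma>" if "x \<in> {0..1}" for x \<tau>
      using infnorm_diff_le_BC1_norm[OF a' \<open>BC1 a\<close> that, of \<tau>]
        infnorm_partial_x_diff_le_BC1_norm[OF a' \<open>BC1 a\<close> that, of \<tau>]
        infnorm_diff_le_BC1_norm[OF b' \<open>BC1 b\<close> that, of \<tau>] a'\<gamma> b'\<gamma>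
      by (auto intro!: norm_le)
    have symV: "transpose (V x \<tau>) = V x \<tau>" if "x \<in> {0..1}" for x \<tau>
      using Vdiag[OF that] by (rule diagonal_symmetric)
    have symVa: "transpose (V x \<tau> ** a' x \<tau>) = V x \<tau> ** a' x \<tau>" if "x \<in> {0..1}" for x \<tau>
      using a'_diag that by (intro diagonal_mult_symmetric Vdiag) (auto simp: diagonal_on_strip_def)
    have dissip: "qform (partial_t UNIV V x \<tau> + partial_x (\<lambda>y \<tau>. V y \<tau> ** a' y \<tau>) x \<tau>
        - V x \<tau> ** b' x \<tau> - transpose (b' x \<tau>) ** V x \<tau>) v \<le> - c * qform (V x \<tau>) v"
      if x: "x \<in> {0..1}" for x \<tau> v
    proof -
      have "(3 * K0 + K1) * (\<kappa> * \<gamma>) * (norm v)\<^sup>2 \<le> (3 * K0 + K1) * (\<kappa> * \<gamma>) * (N * (infnorm v)\<^sup>2)"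
        using \<open>0 < K0\<close> \<open>0 < K1\<close> \<kappa> \<open>0 < \<gamma>\<close> by (intro mult_left_mono norm2) auto
      also have "\<dots> = C1 * \<gamma> * (infnorm v)\<^sup>2" by (simp add: C1_def)
      also have "\<dots> \<le> \<beta>3 / 2 * (infnorm v)\<^sup>2" by (intro mult_right_mono \<gamma>1) simp
      finally have "qform (partial_t UNIV V x \<tau> + partial_x (\<lambda>y \<tau>. V y \<tau> ** a' y \<tau>) x \<tau>
        - V x \<tau> ** b' x \<tau> - transpose (b' x \<tau>) ** V x \<tau>) v \<le> - \<beta>3 * (infnorm v)\<^sup>2 + \<beta>3 / 2 * (infnorm v)\<^sup>2"
        using robust_lyapunov_estimates[where t = \<tau> and b = b and b' = b' and v = v,
            OF V a a'C1 x symV[OF x] K0[OF x] K1[OF x] da[OF x] dax[OF x] db[OF x]] diss[OF x, of \<tau> v] by linarith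
      also have "\<dots> = - c * (\<beta>2 * (infnorm v)\<^sup>2)" using \<beta> by (simp add: c_def)
      also have "\<dots> \<le> - c * qform (V x \<tau>) v"
        using Vup[OF x, of \<tau> v] \<open>0 < c\<close> by simp
      finally show ?thesis .
    qed
    have boundary: "qform (V 0 \<tau> ** a' 0 \<tau>) (J0 m r *v v) \<le> qform (V 1 \<tau> ** a' 1 \<tau>) (J1 m r *v v)" for \<tau> v
    proof -
      let ?J = "(norm (J0 m r))\<^sup>2 + (norm (J1 m r))\<^sup>2"
      have "K0 * (\<kappa> * \<gamma>) * ?J * (norm v)\<^sup>2 \<le> K0 * (\<kappa> * \<gamma>) * ?J * (N * (infnorm v)\<^sup>2)"
        using \<open>0 < K0\<close> \<kappa> \<open>0 < \<gamma>\<close> by (intro mult_left_mono norm2) auto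
      also have "\<dots> = C2 * \<gamma> * (infnorm v)\<^sup>2" by (simp add: C2_def)
      also have "\<dots> \<le> \<beta>4 * (infnorm v)\<^sup>2" by (intro mult_right_mono \<gamma>2) simp
      finally show ?thesis
        using robust_boundary_estimate[of "V 0 \<tau>" K0 "V 1 \<tau>" "a' 0 \<tau>" "a 0 \<tau>" "\<kappa> * \<gamma>"
            "a' 1 \<tau>" "a 1 \<tau>" "J0 m r" v "J1 m r"] K0[of 0 \<tau>] K0[of 1 \<tau>] da[of 0 \<tau>] da[of 1 \<tau>] bdry[of \<tau> v]
        by simp
    qed
    \<comment> \<open>Energy and squared L2 norm are comparable: the lower constant is
      \<open>\<beta>1 / N\<close>, where \<open>N\<close> comes from the change of norm, and the
      upper one is \<open>\<beta>2\<close>.\<close>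
    have decay: "(L2_norm (\<lambda>x. w x t))\<^sup>2 \<le> \<beta>2 * N / \<beta>1 * exp (- c * (t - s)) * (L2_norm \<psi>)\<^sup>2"
      if w: "classical_solution m r a' b' s \<psi> w" for \<psi> w
    proof -
      have w_cont: "continuous_on {0..1} (\<lambda>x. w x \<tau>)" if "s \<le> \<tau>" for \<tau>
        using C1_on_continuous(1)[of "{s..}" w "{0..1}" "\<lambda>x. x" "\<lambda>_. \<tau>"] w that
        by (auto simp: classical_solution_def)
      have int_norm: "(\<lambda>x. (norm (w x \<tau>))\<^sup>2) integrable_on {0..1}" if "s \<le> \<tau>" for \<tau>
        by (intro integrable_continuous_interval continuous_intros w_cont that)
      have V_cont: "continuous_on {0..1} (\<lambda>x. V x \<tau>)" for \<tau>
        using C1_on_continuous(1)[OF V, of "{0..1}" "\<lambda>x. x" "\<lambda>_. \<tau>"] by auto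
      have int_V: "(\<lambda>x. qform (V x \<tau>) (w x \<tau>)) integrable_on {0..1}" if "s \<le> \<tau>" for \<tau>
        by (intro integrable_continuous_interval continuous_intros w_cont that V_cont)
      have "\<beta>1 / N * (L2_norm (\<lambda>x. w x t))\<^sup>2 = integral {0..1} (\<lambda>x. \<beta>1 / N * (norm (w x t))\<^sup>2)"
        using continuous_L2_norm_power2[OF w_cont[OF \<open>s \<le> t\<close>]] by simp
      also have "\<dots> \<le> integral {0..1} (\<lambda>x. qform (V x t) (w x t))"
      proof (rule integral_le)
        fix x :: real assume "x \<in> {0..1}"
        have "\<beta>1 / N * (norm (w x t))\<^sup>2 \<le> \<beta>1 / N * (N * (infnorm (w x t))\<^sup>2)"
          using \<beta> N by (intro mult_left_mono norm2) simp
        also have "\<dots> \<le> qform (V x t) (w x t)"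
          using Vlo[OF \<open>x \<in> {0..1}\<close>] N by simp
        finally show "\<beta>1 / N * (norm (w x t))\<^sup>2 \<le> qform (V x t) (w x t)" .
      qed (intro integrable_on_mult_right int_norm int_V \<open>s \<le> t\<close>)+
      also have "\<dots> \<le> exp (- c * (t - s)) * integral {0..1} (\<lambda>x. qform (V x s) (w x s))"
        by (rule energy_decay[OF V a'C1 w symV symVa dissip boundary \<open>s \<le> t\<close>])
      also have "integral {0..1} (\<lambda>x. qform (V x s) (w x s)) \<le> integral {0..1} (\<lambda>x. \<beta>2 * (norm (w x s))\<^sup>2)"
      proof (rule integral_le)
        fix x :: real assume "x \<in> {0..1}"
        have "\<beta>2 * (infnorm (w x s))\<^sup>2 \<le> \<beta>2 * (norm (w x s))\<^sup>2"
          using \<beta> by (intro mult_left_mono infnorm_power2_le) simp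
        then show "qform (V x s) (w x s) \<le> \<beta>2 * (norm (w x s))\<^sup>2"
          using Vup[OF \<open>x \<in> {0..1}\<close>, of s "w x s"] by linarith
      qed (intro integrable_on_mult_right int_norm int_V order_refl)+
      also have "\<dots> = \<beta>2 * (L2_norm (\<lambda>x. w x s))\<^sup>2"
        using continuous_L2_norm_power2[OF w_cont[OF order_refl]] by simp
      also have "L2_norm (\<lambda>x. w x s) = L2_norm \<psi>"
        using w by (intro L2_norm_cong) (simp add: classical_solution_def)
      finally have "\<beta>1 / N * (L2_norm (\<lambda>x. w x t))\<^sup>2 \<le> exp (- c * (t - s)) * (\<beta>2 * (L2_norm \<psi>)\<^sup>2)"
        by simp
      then show ?thesis
        using \<beta> N by (simp add: field_simps)
    qed
    let ?C = "\<beta>2 * N / \<beta>1 * exp (- c * (t - s))"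
    have "(L2_norm (\<lambda>x. u x t))\<^sup>2 \<le> 4 * ?C * (L2_norm \<phi>)\<^sup>2"
    proof (rule generalized_solution_decay[OF gen \<phi> _ _ \<open>s \<le> t\<close>])
      show "0 \<le> ?C" using \<beta> N by simp
    qed (rule decay)
    also have "\<dots> = (2 * sqrt (\<beta>2 * N / \<beta>1) * exp (- (c / 2) * (t - s)) * L2_norm \<phi>)\<^sup>2"
      using \<beta> N by (simp add: power_mult_distrib flip: exp_double)
    finally have "L2_norm (\<lambda>x. u x t) \<le> 2 * sqrt (\<beta>2 * N / \<beta>1) * exp (- (c / 2) * (t - s)) * L2_norm \<phi>"
      by (rule power2_le_imp_le, intro mult_nonneg_nonneg L2_norm_nonneg) (use \<beta> N in auto)
    also have "\<dots> \<le> M * exp (- (c / 2) * (t - s)) * L2_norm \<phi>"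
      by (intro mult_right_mono L2_norm_nonneg) (auto simp: M_def)
    finally show "L2_norm (\<lambda>x. u x t) \<le> M * exp (- (c / 2) * (t - s)) * L2_norm \<phi>" .
  qed
qed

end
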